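(* Let $\kappa_0=-\frac mn$ with $m,n$ positive integers, and let $\tau$ be a partition of $N$. There is at most one irreducible $S_N$-module of homogeneous polynomials in $x_1,\dots,x_N$, consisting (apart from $0$) of singular polynomials for the singular value $\kappa_0$, that has isotype $\tau$.
   Context: $S_N$ acts on polynomials in $x=(x_1,\ldots,x_N)$ with rational coefficients by $(wf)(x)=f(xw)$, $(xw)_i=x_{w(i)}$; $(i,j)$ is the transposition. Dunkl operators: $\mathcal D_i(\kappa)f=\frac{\partial f}{\partial x_i}+\kappa\sum_{j\ne i}\frac{f-(i,j)f}{x_i-x_j}$. A singular polynomial for $\kappa_0\in\mathbb Q$ is a nonzero polynomial $p$ such that $\mathcal D_i(\kappa_0)p=0$ for $1\le i\le N$. Irreducible representations of $S_N$ are labeled in the standard way by partitions of $N$ (with $(N)$ trivial); an irreducible $S_N$-submodule of the space of homogeneous polynomials of some degree has isotype $\tau$ if it is isomorphic to the representation labeled by $\tau$. *)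

theory Defs
  imports Complex_Main "HOL-Library.Poly_Mapping" "HOL-Combinatorics.Permutations"
begin

section \<open>Rational polynomials\<close>

text \<open>
  A polynomial maps exponent vectors to coefficients.  The variables are indexed by
  all natural numbers; the ring in \<open>x\<^sub>1, \<dots>, x\<^sub>N\<close> is the subset \<open>polys N\<close>.
  Multiplication is the convolution product of the library.
\<close>

type_synonym monom = "nat \<Rightarrow>\<^sub>0 nat"
type_synonym mpoly = "monom \<Rightarrow>\<^sub>0 rat"

definition const :: "rat \<Rightarrow> mpoly" where
  "const c = Poly_Mapping.single 0 c"

definition var :: "nat \<Rightarrow> mpoly" where
  "var i = Poly_Mapping.single (Poly_Mapping.single i 1) 1"

definition scale :: "rat \<Rightarrow> mpoly \<Rightarrow> mpoly" where
  "scale c f = const c * f"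

interpretation mpoly: vector_space scale
proof -
  have "const (a + b) = const a + const b" "const (a * b) = const a * const b" "const 1 = 1" for a b
    by (simp_all add: const_def single_add mult_single)
  then show "vector_space scale"
    by unfold_locales (simp_all add: scale_def algebra_simps)
qed

definition polys :: "nat \<Rightarrow> mpoly set" where
  "polys N = {f. \<forall>\<alpha> \<in> Poly_Mapping.keys f. Poly_Mapping.keys \<alpha> \<subseteq> {1..N}}"

definition homogeneous :: "nat \<Rightarrow> nat \<Rightarrow> mpoly set" where
  "homogeneous N d =
     {f \<in> polys N. \<forall>\<alpha> \<in> Poly_Mapping.keys f. (\<Sum>i = 1..N. Poly_Mapping.lookup \<alpha> i) = d}"

definition subst :: "(nat \<Rightarrow> mpoly) \<Rightarrow> mpoly \<Rightarrow> mpoly" where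
  "subst s f = (\<Sum>\<alpha> \<in> Poly_Mapping.keys f.
     scale (Poly_Mapping.lookup f \<alpha>) (\<Prod>i \<in> Poly_Mapping.keys \<alpha>. s i ^ Poly_Mapping.lookup \<alpha> i))"

text \<open>\<open>(w f)(x) = f(x w)\<close> with \<open>(x w)\<^sub>i = x\<^bsub>w(i)\<^esub>\<close>.\<close>

definition act :: "(nat \<Rightarrow> nat) \<Rightarrow> mpoly \<Rightarrow> mpoly" where
  "act w f = subst (\<lambda>i. var (w i)) f"

text \<open>In the next definition, a truncated subtraction of exponents only occurs
  together with the coefficient \<open>0\<close>.\<close>

definition partial_deriv :: "nat \<Rightarrow> mpoly \<Rightarrow> mpoly" where
  "partial_deriv i f = (\<Sum>\<alpha> \<in> Poly_Mapping.keys f.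
     Poly_Mapping.single (\<alpha> - Poly_Mapping.single i 1)
       (Poly_Mapping.lookup f \<alpha> * of_nat (Poly_Mapping.lookup \<alpha> i)))"


section \<open>Dunkl operators and singular polynomials\<close>

definition divided_difference :: "nat \<Rightarrow> nat \<Rightarrow> mpoly \<Rightarrow> mpoly" where
  "divided_difference i j f =
     (THE q. q * (var i - var j) = f - act (Transposition.transpose i j) f)"

lemma poly_mapping_sum_monomials:
  fixes f :: "'a \<Rightarrow>\<^sub>0 'b::comm_monoid_add"
  shows "(\<Sum>k \<in> Poly_Mapping.keys f. Poly_Mapping.single k (Poly_Mapping.lookup f k)) = f"
  by (rule poly_mapping_eqI)
    (simp add: lookup_sum lookup_single when_def in_keys_iff)

lemma single_eq_prod_var:
  "Poly_Mapping.single \<alpha> (1::rat) =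
     (\<Prod>i \<in> Poly_Mapping.keys \<alpha>. var i ^ Poly_Mapping.lookup \<alpha> i)"
proof -
  have var_power: "var i ^ k = Poly_Mapping.single (Poly_Mapping.single i k) 1" for i k
    by (induction k) (simp_all add: var_def mult_single single_add[symmetric])
  have prod: "(\<Prod>i \<in> A. Poly_Mapping.single (g i) (1::rat)) = Poly_Mapping.single (\<Sum>i \<in> A. g i) 1"
    if "finite A" for A and g :: "nat \<Rightarrow> monom"
    using that by (induction A) (simp_all add: mult_single)
  have "(\<Sum>i \<in> Poly_Mapping.keys \<alpha>. Poly_Mapping.single i (Poly_Mapping.lookup \<alpha> i)) = \<alpha>"
    by (simp add: poly_mapping_sum_monomials)
  then show ?thesis
    by (simp add: var_power prod)
qed

lemma subst_var: "subst var f = f"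
proof -
  have "scale c (Poly_Mapping.single \<alpha> 1) = Poly_Mapping.single \<alpha> c" for c and \<alpha> :: monom
    by (simp add: scale_def const_def mult_single)
  then show ?thesis
    by (simp add: subst_def single_eq_prod_var[symmetric] poly_mapping_sum_monomials)
qed

lemma var_eq_iff: "var i = var j \<longleftrightarrow> i = j"
  by (metis var_def lookup_single_eq lookup_single_not_eq zero_neq_one)

text \<open>The quotient in \<^const>\<open>divided_difference\<close> exists and is unique.\<close>

lemma divided_difference_unique_quotient:
  assumes "i \<noteq> j"
  shows "\<exists>!q. q * (var i - var j) = f - act (Transposition.transpose i j) f"
proof -
  let ?d = "var i - var j" and ?t = "Transposition.transpose i j"
  have d0: "?d \<noteq> 0"
    using assms by (simp add: var_eq_iff)
  have v: "?d dvd var k - var (?t k)" for k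
    by (auto simp: Transposition.transpose_def) (metis dvd_refl dvd_minus_iff minus_diff_eq)
  have mult: "?d dvd a * b - a' * b'" if "?d dvd a - a'" "?d dvd b - b'" for a a' b b' :: mpoly
  proof -
    have "a * b - a' * b' = (a - a') * b + a' * (b - b')"
      by (simp add: algebra_simps)
    with that show ?thesis
      by simp
  qed
  have pow: "?d dvd a ^ k - a' ^ k" if "?d dvd a - a'" for a a' :: mpoly and k
    using that by (induction k) (simp_all add: mult)
  have prod: "?d dvd (\<Prod>k \<in> A. g k) - (\<Prod>k \<in> A. h k)"
    if "finite A" "\<And>k. ?d dvd g k - h k" for A :: "nat set" and g h
    using that by (induction A) (simp_all add: mult)
  have "?d dvd subst var f - subst (\<lambda>k. var (?t k)) f"
    unfolding subst_def sum_subtractf[symmetric] mpoly.scale_right_diff_distrib[symmetric]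
    unfolding scale_def
    by (intro dvd_sum dvd_mult prod pow v finite_keys)
  then obtain q where "q * ?d = f - act ?t f"
    unfolding act_def subst_var by (metis dvdE mult.commute)
  with d0 show ?thesis
    by (metis mult_right_cancel)
qed

definition dunkl :: "nat \<Rightarrow> rat \<Rightarrow> nat \<Rightarrow> mpoly \<Rightarrow> mpoly" where
  "dunkl N \<kappa> i f = partial_deriv i f + scale \<kappa> (\<Sum>j \<in> {1..N} - {i}. divided_difference i j f)"

definition singular :: "nat \<Rightarrow> rat \<Rightarrow> mpoly \<Rightarrow> bool" where
  "singular N \<kappa> p \<longleftrightarrow> p \<in> polys N \<and> p \<noteq> 0 \<and> (\<forall>i \<in> {1..N}. dunkl N \<kappa> i p = 0)"


section \<open>Modules of polynomials for the symmetric group\<close>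

definition sym_submodule :: "nat \<Rightarrow> mpoly set \<Rightarrow> bool" where
  "sym_submodule N M \<longleftrightarrow> M \<subseteq> polys N \<and> mpoly.subspace M \<and>
     (\<forall>w f. w permutes {1..N} \<longrightarrow> f \<in> M \<longrightarrow> act w f \<in> M)"

definition irreducible_submodule :: "nat \<Rightarrow> mpoly set \<Rightarrow> bool" where
  "irreducible_submodule N M \<longleftrightarrow> sym_submodule N M \<and> M \<noteq> {0} \<and>
     (\<forall>L. sym_submodule N L \<and> L \<subseteq> M \<longrightarrow> L = {0} \<or> L = M)"

definition module_isomorphic :: "nat \<Rightarrow> mpoly set \<Rightarrow> mpoly set \<Rightarrow> bool" where
  "module_isomorphic N M M' \<longleftrightarrow> (\<exists>\<phi>. bij_betw \<phi> M M' \<and>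
     (\<forall>f \<in> M. \<forall>g \<in> M. \<phi> (f + g) = \<phi> f + \<phi> g) \<and>
     (\<forall>c. \<forall>f \<in> M. \<phi> (scale c f) = scale c (\<phi> f)) \<and>
     (\<forall>w. w permutes {1..N} \<longrightarrow> (\<forall>f \<in> M. \<phi> (act w f) = act w (\<phi> f))))"


section \<open>The irreducible representation labeled by a partition\<close>

definition is_partition :: "nat list \<Rightarrow> nat \<Rightarrow> bool" where
  "is_partition \<tau> N \<longleftrightarrow> sorted_wrt (\<ge>) \<tau> \<and> 0 \<notin> set \<tau> \<and> sum_list \<tau> = N"

definition diagram :: "nat list \<Rightarrow> (nat \<times> nat) set" where
  "diagram \<tau> = {(r, c). r < length \<tau> \<and> c < \<tau> ! r}"

definition is_tableau :: "nat \<Rightarrow> nat list \<Rightarrow> (nat \<times> nat \<Rightarrow> nat) \<Rightarrow> bool" where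
  "is_tableau N \<tau> T \<longleftrightarrow> bij_betw T (diagram \<tau>) {1..N}"

text \<open>
  The representation labeled by \<open>\<tau>\<close> is the Specht module, in Specht's original realization
  as the span of the Specht polynomials: the polynomial of a tableau is the product, over its
  columns, of the Vandermonde products of the variables indexed by the column entries.
  (Sending the tabloid of a tableau \<open>T\<close> to the monomial in which \<open>x\<^bsub>T(r,c)\<^esub>\<close> has
  exponent \<open>r\<close>, rows counted from \<open>0\<close>, is an equivariant embedding that carries
  polytabloids to Specht polynomials, up to sign.)
  A single row gives the trivial representation, a single column the sign representation.
\<close>

definition specht_poly :: "nat list \<Rightarrow> (nat \<times> nat \<Rightarrow> nat) \<Rightarrow> mpoly" where
  "specht_poly \<tau> T =
     (\<Prod>(r, s, c) \<in> {(r, s, c). r < s \<and> (r, c) \<in> diagram \<tau> \<and> (s, c) \<in> diagram \<tau>}.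
        var (T (r, c)) - var (T (s, c)))"

definition specht_module :: "nat \<Rightarrow> nat list \<Rightarrow> mpoly set" where
  "specht_module N \<tau> = mpoly.span (specht_poly \<tau> ` {T. is_tableau N \<tau> T})"

definition has_isotype :: "nat \<Rightarrow> nat list \<Rightarrow> mpoly set \<Rightarrow> bool" where
  "has_isotype N \<tau> M \<longleftrightarrow> module_isomorphic N M (specht_module N \<tau>)"

end

theory Submission
  imports Defs "HOL-Library.Product_Lexorder"
begin

text \<open>
  Since \<open>D\<^sub>i f = 0\<close> for singular \<open>f\<close>, the operator \<open>x\<^sub>i D\<^sub>i\<close> plus \<open>\<kappa>\<close> times the \<open>i\<close>-th
  Jucys--Murphy element acts on \<open>f\<close> as the latter multiple alone, and it is triangular on monomials.
  So the exponent \<open>\<alpha>\<close> of an extremal monomial of a joint Jucys--Murphy eigenvector is tied to the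
  contents \<open>c\<^sub>i\<close> of a standard tableau: \<open>n \<alpha>\<^sub>i = m (\<rho>\<^sub>i - c\<^sub>i)\<close>, where \<open>\<rho>\<^sub>i\<close> is the rank of
  \<open>\<alpha>\<^sub>i\<close>.  A single eigenvector does not determine \<open>\<alpha>\<close>.  But a vector symmetric along the rows
  and one antisymmetric along the columns have extremal exponents in the same orbit, and together they force
  the ranks to follow the reading order of the diagram.  Hence two copies of the module have the same
  extremal exponent, a linear combination of the two embeddings loses it, and therefore vanishes.
\<close>

text \<open>The obstacle is circularity: the rank \<rho> is itself computed from \<alpha>, so the
  relation cannot simply be solved for \<alpha>. The sign of \<kappa> helps: exponents weakly
  increase with rank, hence contents rise by at most one from each rank to the next. Symmetry makes
  the ranks of the one vector increase along rows, antisymmetry makes those of the other increase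
  down columns. Each is half of what a standard filling satisfies, and the halves can be combined
  because both rank functions list the same sequence of contents. "Extremal" means maximal for the
  sum of squares of the exponents, a permutation-invariant number that replaces the dominance order.
  The argument is phrased for equivariant maps out of the Specht module, since maps can be combined
  linearly even when their images lie in different degrees; equality of the degrees is part of the
  conclusion. Irreducibility of the Specht module comes from the given module by transport along the
  isomorphism.\<close>

abbreviation "lookup \<equiv> Poly_Mapping.lookup"
abbreviation "keys \<equiv> Poly_Mapping.keys"

section \<open>Substitutions and the action of permutations\<close>

lemma scale_mult_left: "scale c f * g = scale c (f * g)"
  by (simp add: scale_def mult.assoc)

lemma scale_mult_right: "f * scale c g = scale c (f * g)"
  by (simp add: scale_def algebra_simps)

lemma scale_single: "scale c (Poly_Mapping.single \<alpha> d) = Poly_Mapping.single \<alpha> (c * d)"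
  by (simp add: scale_def const_def mult_single)

lemma lookup_scale [simp]: "lookup (scale c f) \<alpha> = c * lookup f \<alpha>"
  by (simp add: scale_def const_def mult_map_scale_conv_mult [symmetric] map.rep_eq when_def)

lemma keys_scale: "keys (scale c f) \<subseteq> keys f"
  by (auto simp: in_keys_iff)

definition monomial_value :: "(nat \<Rightarrow> mpoly) \<Rightarrow> monom \<Rightarrow> mpoly" where
  "monomial_value s \<alpha> = (\<Prod>i \<in> keys \<alpha>. s i ^ lookup \<alpha> i)"

lemma monomial_value_superset:
  assumes "finite K" "keys \<alpha> \<subseteq> K"
  shows "monomial_value s \<alpha> = (\<Prod>i \<in> K. s i ^ lookup \<alpha> i)"
  unfolding monomial_value_def
  by (rule prod.mono_neutral_left) (use assms in \<open>auto simp: in_keys_iff\<close>)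

lemma monomial_value_add: "monomial_value s (\<alpha> + \<beta>) = monomial_value s \<alpha> * monomial_value s \<beta>"
  using monomial_value_superset [of "keys \<alpha> \<union> keys \<beta>" \<alpha> s]
    monomial_value_superset [of "keys \<alpha> \<union> keys \<beta>" \<beta> s]
    monomial_value_superset [of "keys \<alpha> \<union> keys \<beta>" "\<alpha> + \<beta>" s]
    Poly_Mapping.keys_add [of \<alpha> \<beta>]
  by (simp add: lookup_add power_add prod.distrib)

lemma subst_superset:
  assumes "finite K" "keys f \<subseteq> K"
  shows "subst s f = (\<Sum>\<alpha> \<in> K. scale (lookup f \<alpha>) (monomial_value s \<alpha>))"
  unfolding subst_def monomial_value_def [symmetric]
  by (rule sum.mono_neutral_left) (use assms in \<open>auto simp: in_keys_iff\<close>)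

lemma subst_add: "subst s (f + g) = subst s f + subst s g"
  using subst_superset [of "keys f \<union> keys g" f s]
    subst_superset [of "keys f \<union> keys g" g s]
    subst_superset [of "keys f \<union> keys g" "f + g" s]
    Poly_Mapping.keys_add [of f g]
  by (simp add: lookup_add mpoly.scale_left_distrib sum.distrib)

lemma subst_scale: "subst s (scale c f) = scale c (subst s f)"
  using subst_superset [of "keys f" "scale c f" s] subst_superset [of "keys f" f s] keys_scale
  by (simp add: mpoly.scale_sum_right)

lemma subst_0 [simp]: "subst s 0 = 0"
  by (simp add: subst_def)

lemma subst_sum: "subst s (\<Sum>x \<in> A. f x) = (\<Sum>x \<in> A. subst s (f x))"
  by (induction A rule: infinite_finite_induct) (simp_all add: subst_add)

lemma subst_single: "subst s (Poly_Mapping.single \<alpha> c) = scale c (monomial_value s \<alpha>)"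
  using subst_superset [of "{\<alpha>}" "Poly_Mapping.single \<alpha> c" s] by simp

lemma subst_mult: "subst s (f * g) = subst s f * subst s g"
proof -
  have 1: "subst s (Poly_Mapping.single \<alpha> a * Poly_Mapping.single \<beta> b) =
      subst s (Poly_Mapping.single \<alpha> a) * subst s (Poly_Mapping.single \<beta> b)" for \<alpha> \<beta> a b
    by (simp add: mult_single subst_single monomial_value_add scale_mult_left scale_mult_right)
  have "subst s ((\<Sum>\<alpha> \<in> keys f. Poly_Mapping.single \<alpha> (lookup f \<alpha>)) *
      (\<Sum>\<beta> \<in> keys g. Poly_Mapping.single \<beta> (lookup g \<beta>))) =
      subst s (\<Sum>\<alpha> \<in> keys f. Poly_Mapping.single \<alpha> (lookup f \<alpha>)) *
      subst s (\<Sum>\<beta> \<in> keys g. Poly_Mapping.single \<beta> (lookup g \<beta>))"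
    by (simp add: subst_sum sum_product 1)
  then show ?thesis
    by (simp add: poly_mapping_sum_monomials)
qed

lemma subst_one [simp]: "subst s 1 = 1"
  using subst_single [of s 0 1] by (simp add: monomial_value_def)

lemma subst_diff: "subst s (f - g) = subst s f - subst s g"
  using subst_add [of s "f - g" g] by (simp add: algebra_simps)

lemma subst_var_apply [simp]: "subst s (var i) = s i"
  by (simp add: var_def subst_single monomial_value_def)

lemma subst_prod: "subst s (\<Prod>x \<in> A. f x) = (\<Prod>x \<in> A. subst s (f x))"
  by (induction A rule: infinite_finite_induct) (simp_all add: subst_mult)

lemma subst_power: "subst s (f ^ k) = subst s f ^ k"
  by (induction k) (simp_all add: subst_mult)

lemma subst_subst: "subst s (subst t f) = subst (\<lambda>i. subst s (t i)) f"
  by (simp add: subst_def [of t] subst_def [of "\<lambda>i. subst s (t i)"] subst_sum subst_scale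
      subst_prod subst_power)

lemma act_add: "act w (f + g) = act w f + act w g"
  and act_diff: "act w (f - g) = act w f - act w g"
  and act_scale: "act w (scale c f) = scale c (act w f)"
  and act_sum: "act w (\<Sum>x \<in> A. h x) = (\<Sum>x \<in> A. act w (h x))"
  and act_prod: "act w (\<Prod>x \<in> A. h x) = (\<Prod>x \<in> A. act w (h x))"
  and act_var: "act w (var i) = var (w i)"
  and act_0 [simp]: "act w 0 = 0"
  and act_id [simp]: "act id f = f"
  by (simp_all add: act_def subst_add subst_diff subst_scale subst_sum subst_prod subst_var)

lemma act_uminus: "act w (- f) = - act w f"
  using act_diff [of w 0 f] by simp

lemma act_act: "act v (act w f) = act (v \<circ> w) f"
  by (simp add: act_def subst_subst)

lemma subst_act: "subst s (act w f) = subst (s \<circ> w) f"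
  by (simp add: act_def subst_subst comp_def)

lemma lookup_map_key: "inj w \<Longrightarrow> lookup (Poly_Mapping.map_key w \<alpha>) i = lookup \<alpha> (w i)"
  by (simp add: map_key.rep_eq)

lemma act_single:
  assumes "bij w"
  shows "act w (Poly_Mapping.single \<alpha> c) = Poly_Mapping.single (Poly_Mapping.map_key (inv w) \<alpha>) c"
proof -
  let ?\<beta> = "Poly_Mapping.map_key (inv w) \<alpha>"
  have inj: "inj (inv w)" "inj w"
    using assms by (auto simp: bij_imp_bij_inv bij_is_inj)
  have keys: "keys ?\<beta> = w ` keys \<alpha>"
  proof (intro equalityI subsetI)
    fix i assume "i \<in> keys ?\<beta>"
    then have "inv w i \<in> keys \<alpha>"
      by (simp add: in_keys_iff lookup_map_key inj)
    moreover have "w (inv w i) = i"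
      using assms by (simp add: bij_is_surj surj_f_inv_f)
    ultimately show "i \<in> w ` keys \<alpha>"
      by force
  qed (use inj in \<open>auto simp: in_keys_iff lookup_map_key inv_f_f\<close>)
  have "monomial_value (\<lambda>i. var (w i)) \<alpha> = (\<Prod>i \<in> keys ?\<beta>. var i ^ lookup ?\<beta> i)"
    unfolding keys monomial_value_def
    using inj by (simp add: prod.reindex inj_on_subset [OF inj(2)] lookup_map_key)
  then show ?thesis
    by (simp add: act_def subst_single single_eq_prod_var [symmetric] scale_single)
qed

text \<open>The permutation \<open>w\<close> carries the monomial with exponent \<beta> to the one
  with exponent \<beta> o w^-1, so the coefficient at \<alpha> comes from \<beta> = \<alpha> o w: on
  coefficients no inverse appears.\<close>

lemma lookup_act:
  assumes "bij w"
  shows "lookup (act w f) \<alpha> = lookup f (Poly_Mapping.map_key w \<alpha>)"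
proof -
  have inj: "inj (inv w)" "inj w"
    using assms by (auto simp: bij_imp_bij_inv bij_is_inj)
  have eq: "Poly_Mapping.map_key (inv w) \<beta> = \<alpha> \<longleftrightarrow> \<beta> = Poly_Mapping.map_key w \<alpha>" for \<beta>
  proof
    assume "Poly_Mapping.map_key (inv w) \<beta> = \<alpha>"
    then show "\<beta> = Poly_Mapping.map_key w \<alpha>"
      by (intro poly_mapping_eqI) (auto simp: lookup_map_key inj inv_f_f)
  next
    assume "\<beta> = Poly_Mapping.map_key w \<alpha>"
    then show "Poly_Mapping.map_key (inv w) \<beta> = \<alpha>"
      by (intro poly_mapping_eqI) (simp add: lookup_map_key inj assms bij_is_surj surj_f_inv_f)
  qed
  have "act w f = (\<Sum>\<beta> \<in> keys f. act w (Poly_Mapping.single \<beta> (lookup f \<beta>)))"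
    by (subst poly_mapping_sum_monomials [of f, symmetric]) (simp add: act_sum)
  then show ?thesis
    by (simp add: lookup_sum act_single assms lookup_single eq when_def in_keys_iff)
qed

section \<open>Coefficients after multiplication by a monomial\<close>

lemma lookup_single_mult:
  "lookup (Poly_Mapping.single \<mu> (1::rat) * f) (\<mu> + \<alpha>) = lookup f (\<alpha>::monom)"
proof -
  have "Poly_Mapping.single \<mu> 1 * f = (\<Sum>\<beta> \<in> keys f. Poly_Mapping.single (\<mu> + \<beta>) (lookup f \<beta>))"
    by (subst poly_mapping_sum_monomials [of f, symmetric]) (simp add: sum_distrib_left mult_single)
  then show ?thesis
    by (simp add: lookup_sum lookup_single when_def in_keys_iff)
qed

lemma lookup_single_mult_eq_0:
  assumes "\<And>\<beta>. \<alpha> \<noteq> \<mu> + \<beta>"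
  shows "lookup (Poly_Mapping.single \<mu> (1::rat) * f) (\<alpha>::monom) = 0"
proof -
  have "Poly_Mapping.single \<mu> 1 * f = (\<Sum>\<beta> \<in> keys f. Poly_Mapping.single (\<mu> + \<beta>) (lookup f \<beta>))"
    by (subst poly_mapping_sum_monomials [of f, symmetric]) (simp add: sum_distrib_left mult_single)
  then show ?thesis
    using assms by (metis (mono_tags, lifting) lookup_sum lookup_single_not_eq sum.neutral)
qed

lemma lookup_var_mult:
  assumes "\<And>k. lookup \<beta> k = lookup \<alpha> k + (if k = i then 1 else 0)"
  shows "lookup (var i * f) \<beta> = lookup f \<alpha>"
proof -
  have "\<beta> = Poly_Mapping.single i 1 + \<alpha>"
    by (rule poly_mapping_eqI) (use assms in \<open>simp add: lookup_add lookup_single when_def\<close>)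
  then show ?thesis
    by (simp add: var_def lookup_single_mult)
qed

lemma lookup_var_mult_eq_0: "lookup \<beta> i = 0 \<Longrightarrow> lookup (var i * f) \<beta> = 0"
  unfolding var_def by (rule lookup_single_mult_eq_0) (auto simp: lookup_add)

text \<open>The factor x_i undoes the degree shift: x_i d/dx_i is diagonal on monomials, and the
  truncated subtraction in \<open>partial_deriv\<close> disappears. The same factor is put in front
  of the Dunkl operators below.\<close>

lemma lookup_var_mult_partial_deriv:
  "lookup (var i * partial_deriv i f) \<alpha> = of_nat (lookup \<alpha> i) * lookup f \<alpha>"
proof -
  let ?e = "Poly_Mapping.single i (1::nat)"
  have "var i * partial_deriv i f =
      (\<Sum>\<beta> \<in> keys f. Poly_Mapping.single \<beta> (lookup f \<beta> * of_nat (lookup \<beta> i)))"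
    unfolding partial_deriv_def sum_distrib_left
  proof (rule sum.cong [OF refl])
    fix \<beta>
    have "?e + (\<beta> - ?e) = \<beta>" if "lookup \<beta> i \<noteq> 0"
      by (rule poly_mapping_eqI) (use that in \<open>auto simp: lookup_add lookup_minus lookup_single when_def\<close>)
    then show "var i * Poly_Mapping.single (\<beta> - ?e) (lookup f \<beta> * of_nat (lookup \<beta> i)) =
        Poly_Mapping.single \<beta> (lookup f \<beta> * of_nat (lookup \<beta> i))"
      by (cases "lookup \<beta> i = 0") (simp_all add: var_def mult_single)
  qed
  then show ?thesis
    by (simp add: lookup_sum lookup_single when_def in_keys_iff mult.commute)
qed

section \<open>Extremal coefficients of Dunkl operators\<close>

lemma divided_difference_mult:
  assumes "i \<noteq> j"
  shows "divided_difference i j f * (var i - var j) = f - act (Transposition.transpose i j) f"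
  unfolding divided_difference_def
  by (rule theI' [OF divided_difference_unique_quotient [OF assms]])

definition set_exps :: "nat \<Rightarrow> nat \<Rightarrow> monom \<Rightarrow> nat \<Rightarrow> nat \<Rightarrow> monom" where
  "set_exps i j \<alpha> p q = Poly_Mapping.update i p (Poly_Mapping.update j q \<alpha>)"

lemma lookup_set_exps:
  "lookup (set_exps i j \<alpha> p q) k = (if k = i then p else if k = j then q else lookup \<alpha> k)"
  by (simp add: set_exps_def lookup_update)

lemma set_exps_same: "i \<noteq> j \<Longrightarrow> set_exps i j \<alpha> (lookup \<alpha> i) (lookup \<alpha> j) = \<alpha>"
  by (rule poly_mapping_eqI) (simp add: lookup_set_exps)

lemma map_key_transpose_set_exps:
  "i \<noteq> j \<Longrightarrow> Poly_Mapping.map_key (Transposition.transpose i j) (set_exps i j \<alpha> p q) = set_exps i j \<alpha> q p"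
  by (rule poly_mapping_eqI)
    (auto simp: lookup_map_key lookup_set_exps Transposition.transpose_def)

text \<open>With s the transposition and h the product on the left, comparing coefficients in (x_i -
  x_j) h = x_i (f - s f) gives a recursion that moves one unit of exponent from j to i. It stops
  when j has none left, which leaves a finite sum.\<close>

lemma lookup_var_mult_divided_difference:
  assumes "i \<noteq> j"
  shows "lookup (var i * divided_difference i j f) (set_exps i j \<alpha> p q) =
    (\<Sum>t\<le>q. lookup f (set_exps i j \<alpha> (p + t) (q - t)) - lookup f (set_exps i j \<alpha> (q - t) (p + t)))"
proof -
  define h where "h = var i * divided_difference i j f"
  let ?E = "set_exps i j \<alpha>" and ?t = "Transposition.transpose i j"
  have "var i * h - var j * h = var i * (divided_difference i j f * (var i - var j))"
    by (simp add: h_def algebra_simps)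
  also have "\<dots> = var i * (f - act ?t f)"
    by (simp only: divided_difference_mult [OF assms])
  finally have eq: "lookup (var i * h) \<beta> - lookup (var j * h) \<beta> = lookup (var i * (f - act ?t f)) \<beta>" for \<beta>
    by (metis lookup_minus)
  have rec: "lookup h (?E p q) = lookup f (?E p q) - lookup f (?E q p) +
      (if q = 0 then 0 else lookup h (?E (Suc p) (q - 1)))" for p q
  proof -
    have 1: "lookup (var i * g) (?E (Suc p) q) = lookup g (?E p q)" for g
      by (rule lookup_var_mult) (use assms in \<open>simp add: lookup_set_exps\<close>)
    have 2: "lookup (var j * h) (?E (Suc p) q) = lookup h (?E (Suc p) (q - 1))" if "q \<noteq> 0"
      by (rule lookup_var_mult) (use assms that in \<open>simp add: lookup_set_exps\<close>)
    have 3: "lookup (var j * h) (?E (Suc p) q) = 0" if "q = 0"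
      by (rule lookup_var_mult_eq_0) (use assms that in \<open>simp add: lookup_set_exps\<close>)
    show ?thesis
      using eq [of "?E (Suc p) q"] 2 3 assms
      unfolding 1 by (cases "q = 0") (simp_all add: lookup_minus lookup_act map_key_transpose_set_exps)
  qed
  have "lookup h (?E p q) = (\<Sum>t\<le>q. lookup f (?E (p + t) (q - t)) - lookup f (?E (q - t) (p + t)))"
  proof (induction q arbitrary: p)
    case 0
    then show ?case
      by (subst rec) simp
  next
    case (Suc q)
    show ?case
      by (subst rec) (simp add: Suc.IH sum.atMost_Suc_shift del: sum.atMost_Suc)
  qed
  then show ?thesis
    by (simp add: h_def)
qed

text \<open>In the sum over shifts t, extremality kills every term in which the larger of the two
  exponents grows. If \<alpha>_i > \<alpha>_j, only t = 0 survives. Otherwise the shifts up to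
  \<alpha>_j - \<alpha>_i survive, and the two halves of the difference cancel under t -> \<alpha>_j
  - \<alpha>_i - t.\<close>

lemma lookup_var_mult_divided_difference_extremal:
  assumes "i \<noteq> j"
    and extremal: "\<And>p q. p + q = lookup \<alpha> i + lookup \<alpha> j \<Longrightarrow>
      max (lookup \<alpha> i) (lookup \<alpha> j) < max p q \<Longrightarrow> lookup f (set_exps i j \<alpha> p q) = 0"
  shows "lookup (var i * divided_difference i j f) \<alpha> =
    (if lookup \<alpha> j < lookup \<alpha> i
     then lookup f \<alpha> - lookup f (Poly_Mapping.map_key (Transposition.transpose i j) \<alpha>) else 0)"
proof -
  let ?E = "set_exps i j \<alpha>"
  define p q where "p = lookup \<alpha> i" and "q = lookup \<alpha> j"
  have \<alpha>: "?E p q = \<alpha>"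
    by (simp add: p_def q_def set_exps_same assms)
  have \<alpha>': "?E q p = Poly_Mapping.map_key (Transposition.transpose i j) \<alpha>"
    by (metis \<alpha> map_key_transpose_set_exps assms(1))
  let ?g = "\<lambda>t. lookup f (?E (p + t) (q - t)) - lookup f (?E (q - t) (p + t))"
  have sum: "lookup (var i * divided_difference i j f) \<alpha> = (\<Sum>t\<le>q. ?g t)"
    using lookup_var_mult_divided_difference [OF assms(1), of f \<alpha> p q] by (simp add: \<alpha>)
  have 0: "?g t = 0" if "t \<le> q" "max p q < p + t" for t
  proof -
    have "lookup f (?E (p + t) (q - t)) = 0" "lookup f (?E (q - t) (p + t)) = 0"
      using that by (auto intro!: extremal simp: p_def q_def)
    then show ?thesis
      by simp
  qed
  show ?thesis
  proof (cases "q < p")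
    case True
    have "(\<Sum>t\<le>q. ?g t) = (\<Sum>t\<in>{0}. ?g t)"
      by (rule sum.mono_neutral_right) (use True 0 in auto)
    then show ?thesis
      using True by (simp add: sum \<alpha> \<alpha>' flip: p_def q_def)
  next
    case False
    have "(\<Sum>t\<le>q. ?g t) = (\<Sum>t\<le>q - p. ?g t)"
      by (rule sum.mono_neutral_right) (use False in \<open>auto intro!: 0 [simplified]\<close>)
    also have "\<dots> = (\<Sum>t\<le>q - p. lookup f (?E (p + t) (q - t))) -
        (\<Sum>t\<le>q - p. lookup f (?E (q - t) (p + t)))"
      by (rule sum_subtractf)
    also have "(\<Sum>t\<le>q - p. lookup f (?E (q - t) (p + t))) = (\<Sum>t\<le>q - p. lookup f (?E (p + t) (q - t)))"
      by (rule sum.reindex_bij_witness [of _ "\<lambda>t. q - p - t" "\<lambda>t. q - p - t"])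
        (use False in auto)
    finally show ?thesis
      using False by (simp add: sum flip: p_def q_def)
  qed
qed

text \<open>A numerical stand-in for the dominance order: spreading two exponents apart at fixed sum
  increases it, and permuting exponents leaves it unchanged.\<close>

definition sum_squares :: "nat \<Rightarrow> monom \<Rightarrow> nat" where
  "sum_squares N \<alpha> = (\<Sum>i = 1..N. (lookup \<alpha> i)\<^sup>2)"

lemma sum_squares_less:
  fixes a b p q :: nat
  assumes "p + q = a + b" "max a b < max p q"
  shows "a\<^sup>2 + b\<^sup>2 < p\<^sup>2 + q\<^sup>2"
proof -
  have *: "x\<^sup>2 + y\<^sup>2 < u\<^sup>2 + v\<^sup>2" if "u + v = x + y" "y \<le> x" "x < u" for x y u v :: int
  proof -
    have v: "v = x + y - u"
      using that(1) by simp
    \<comment> \<open>The difference is 2 (u - x) (u - y), split here so that each summand has an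
      evident sign.\<close>
    have "u\<^sup>2 + v\<^sup>2 - (x\<^sup>2 + y\<^sup>2) = 2 * ((u - x) * (x - y) + (u - x) * (u - x))"
      unfolding v by (simp add: power2_eq_square algebra_simps)
    moreover have "0 \<le> (u - x) * (x - y)" "0 < (u - x) * (u - x)"
      using that by simp_all
    ultimately have "0 < u\<^sup>2 + v\<^sup>2 - (x\<^sup>2 + y\<^sup>2)"
      by (metis add_nonneg_pos mult_pos_pos zero_less_numeral)
    then show ?thesis
      by simp
  qed
  have "int a ^ 2 + int b ^ 2 < int p ^ 2 + int q ^ 2"
    using assms *[of "int p" "int q" "int a" "int b"] *[of "int q" "int p" "int a" "int b"]
      *[of "int p" "int q" "int b" "int a"] *[of "int q" "int p" "int b" "int a"]
    by (auto simp: max_def algebra_simps split: if_splits)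
  then show ?thesis
    by (metis of_nat_add of_nat_less_iff of_nat_power)
qed

lemma sum_squares_set_exps:
  assumes "i \<noteq> j" "i \<in> {1..N}" "j \<in> {1..N}"
    and "p + q = lookup \<alpha> i + lookup \<alpha> j" "max (lookup \<alpha> i) (lookup \<alpha> j) < max p q"
  shows "sum_squares N \<alpha> < sum_squares N (set_exps i j \<alpha> p q)"
proof -
  have split: "sum_squares N \<beta> = (lookup \<beta> i)\<^sup>2 + (lookup \<beta> j)\<^sup>2 + (\<Sum>k \<in> {1..N} - {i} - {j}. (lookup \<beta> k)\<^sup>2)" for \<beta>
    unfolding sum_squares_def using assms(1-3)
      sum.remove [of "{1..N}" i "\<lambda>k. (lookup \<beta> k)\<^sup>2"]
      sum.remove [of "{1..N} - {i}" j "\<lambda>k. (lookup \<beta> k)\<^sup>2"] by simp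
  have "(\<Sum>k \<in> {1..N} - {i} - {j}. (lookup (set_exps i j \<alpha> p q) k)\<^sup>2) =
      (\<Sum>k \<in> {1..N} - {i} - {j}. (lookup \<alpha> k)\<^sup>2)"
    by (rule sum.cong) (auto simp: lookup_set_exps)
  then show ?thesis
    using sum_squares_less [OF assms(4,5)] assms(1)
    by (simp add: split lookup_set_exps)
qed

text \<open>This is x_i D_i f = 0 read at \<alpha>. Moving exponent between two places so that their
  maximum grows raises the sum of squares, so every divided difference takes its extremal
  form.\<close>

lemma dunkl_kernel_extremal:
  assumes "dunkl N \<kappa> i f = 0" "i \<in> {1..N}"
    and "\<And>\<beta>. sum_squares N \<alpha> < sum_squares N \<beta> \<Longrightarrow> lookup f \<beta> = 0"
  shows "of_nat (lookup \<alpha> i) * lookup f \<alpha> + \<kappa> * (\<Sum>j \<in> {1..N} - {i}.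
    if lookup \<alpha> j < lookup \<alpha> i
    then lookup f \<alpha> - lookup f (Poly_Mapping.map_key (Transposition.transpose i j) \<alpha>) else 0) = 0"
proof -
  have "lookup (var i * divided_difference i j f) \<alpha> =
      (if lookup \<alpha> j < lookup \<alpha> i
       then lookup f \<alpha> - lookup f (Poly_Mapping.map_key (Transposition.transpose i j) \<alpha>) else 0)"
    if "j \<in> {1..N} - {i}" for j
  proof (rule lookup_var_mult_divided_difference_extremal)
    show "i \<noteq> j"
      using that by auto
    fix p q
    assume "p + q = lookup \<alpha> i + lookup \<alpha> j" "max (lookup \<alpha> i) (lookup \<alpha> j) < max p q"
    then show "lookup f (set_exps i j \<alpha> p q) = 0"
      using that assms(2) by (intro assms(3) sum_squares_set_exps) auto
  qed
  moreover have "var i * dunkl N \<kappa> i f = var i * partial_deriv i f +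
      scale \<kappa> (\<Sum>j \<in> {1..N} - {i}. var i * divided_difference i j f)"
    by (simp add: dunkl_def distrib_left scale_mult_right sum_distrib_left)
  from arg_cong [OF this, of "\<lambda>g. lookup g \<alpha>"] have "lookup (var i * partial_deriv i f) \<alpha> +
      \<kappa> * (\<Sum>j \<in> {1..N} - {i}. lookup (var i * divided_difference i j f) \<alpha>) = 0"
    by (simp add: assms(1) lookup_add lookup_sum)
  ultimately show ?thesis
    by (simp add: lookup_var_mult_partial_deriv)
qed

section \<open>Ranks of exponent vectors\<close>

definition count_below :: "nat \<Rightarrow> monom \<Rightarrow> nat \<Rightarrow> nat" where
  "count_below N \<alpha> v = card {j \<in> {1..N}. lookup \<alpha> j < v}"

text \<open>The zero-based place of \<open>i\<close> when indices are sorted by increasing exponent,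
  ties broken by index. Splitting off \<open>count_below\<close>, which is constant on permutation
  orbits, lets ranks in two exponents of one orbit be compared.\<close>

definition rank :: "nat \<Rightarrow> monom \<Rightarrow> nat \<Rightarrow> nat" where
  "rank N \<alpha> i = count_below N \<alpha> (lookup \<alpha> i) + card {j \<in> {1..<i}. lookup \<alpha> j = lookup \<alpha> i}"

lemma rank_less_count_below:
  assumes "i \<in> {1..N}"
  shows "rank N \<alpha> i < count_below N \<alpha> (Suc (lookup \<alpha> i))"
proof -
  have "rank N \<alpha> i = card ({j \<in> {1..N}. lookup \<alpha> j < lookup \<alpha> i} \<union> {j \<in> {1..<i}. lookup \<alpha> j = lookup \<alpha> i})"
    unfolding rank_def count_below_def by (subst card_Un_disjoint) auto
  also have "\<dots> < count_below N \<alpha> (Suc (lookup \<alpha> i))"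
    unfolding count_below_def by (rule psubset_card_mono) (use assms in auto)
  finally show ?thesis .
qed

lemma count_below_mono: "v \<le> u \<Longrightarrow> count_below N \<alpha> v \<le> count_below N \<alpha> u"
  unfolding count_below_def by (rule card_mono) auto

text \<open>Each value owns a block of consecutive ranks whose ends are given by
  \<open>count_below\<close> alone; a larger value owns a later block, even in another exponent with
  the same \<open>count_below\<close>.\<close>

lemma rank_less_rank:
  assumes "i \<in> {1..N}" "lookup \<alpha> i < lookup \<beta> j" "count_below N \<alpha> = count_below N \<beta>"
  shows "rank N \<alpha> i < rank N \<beta> j"
proof -
  have "rank N \<alpha> i < count_below N \<beta> (Suc (lookup \<alpha> i))"
    using rank_less_count_below [OF assms(1)] assms(3) by metis
  also have "\<dots> \<le> count_below N \<beta> (lookup \<beta> j)"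
    using assms(2) by (intro count_below_mono) simp
  also have "\<dots> \<le> rank N \<beta> j"
    by (simp add: rank_def)
  finally show ?thesis .
qed

lemma rank_less_tie:
  assumes "i \<in> {1..N}" "i < j" "lookup \<alpha> i = lookup \<alpha> j"
  shows "rank N \<alpha> i < rank N \<alpha> j"
  unfolding rank_def assms(3)
  by (intro add_strict_left_mono psubset_card_mono) (use assms in auto)

lemma bij_betw_rank: "bij_betw (rank N \<alpha>) {1..N} {..<N}"
proof -
  have inj: "inj_on (rank N \<alpha>) {1..N}"
  proof (rule inj_onI)
    fix i j assume ij: "i \<in> {1..N}" "j \<in> {1..N}" "rank N \<alpha> i = rank N \<alpha> j"
    then have "lookup \<alpha> i = lookup \<alpha> j"
      using rank_less_rank [of i N \<alpha> \<alpha> j] rank_less_rank [of j N \<alpha> \<alpha> i] by fastforce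
    then show "i = j"
      using ij rank_less_tie [of i N j \<alpha>] rank_less_tie [of j N i \<alpha>]
      by (metis less_irrefl linorder_neqE_nat)
  qed
  have "rank N \<alpha> ` {1..N} \<subseteq> {..<N}"
  proof
    fix s assume "s \<in> rank N \<alpha> ` {1..N}"
    then obtain i where "i \<in> {1..N}" "s = rank N \<alpha> i"
      by blast
    moreover have "count_below N \<alpha> (Suc (lookup \<alpha> i)) \<le> card {1..N}"
      unfolding count_below_def by (rule card_mono) auto
    ultimately show "s \<in> {..<N}"
      using rank_less_count_below [of i N \<alpha>] by simp
  qed
  then have "rank N \<alpha> ` {1..N} = {..<N}"
    by (intro card_subset_eq)
      (simp_all only: finite_lessThan card_image [OF inj] card_atLeastAtMost card_lessThan diff_Suc_1)
  with inj show ?thesis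
    by (simp add: bij_betw_def)
qed

text \<open>The Jucys--Murphy sum complements the Dunkl sum. Let F be the coefficient at \<alpha>
  and s_j the one after exchanging i and j. For j < i, a smaller exponent at j contributes (F - s_j)
  + s_j, a tie contributes s_j = F, and a larger one contributes 0 by sortedness. For j > i, a
  smaller exponent contributes F, again by sortedness. The number of F's is exactly the
  rank.\<close>

lemma extremal_eigenvalue:
  assumes dunkl: "dunkl N \<kappa> i f = 0" and i: "i \<in> {1..N}"
    and murphy: "(\<Sum>j \<in> {1..<i}. act (Transposition.transpose i j) f) = scale c f"
    and top: "\<And>\<beta>. sum_squares N \<alpha> < sum_squares N \<beta> \<Longrightarrow> lookup f \<beta> = 0"
    and sorted: "\<And>a b. a \<in> {1..N} \<Longrightarrow> b \<in> {1..N} \<Longrightarrow> a < b \<Longrightarrow> lookup \<alpha> b < lookup \<alpha> a \<Longrightarrow>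
      lookup f (Poly_Mapping.map_key (Transposition.transpose a b) \<alpha>) = 0"
    and nz: "lookup f \<alpha> \<noteq> 0"
  shows "of_nat (lookup \<alpha> i) + \<kappa> * of_nat (rank N \<alpha> i) = \<kappa> * c"
proof -
  let ?s = "\<lambda>j. lookup f (Poly_Mapping.map_key (Transposition.transpose i j) \<alpha>)"
  let ?d = "\<lambda>j. if lookup \<alpha> j < lookup \<alpha> i then lookup f \<alpha> - ?s j else 0"
  let ?F = "lookup f \<alpha>"
  have c: "c * ?F = (\<Sum>j \<in> {1..<i}. ?s j)"
    using arg_cong [OF murphy, of "\<lambda>g. lookup g \<alpha>"] by (simp add: lookup_sum lookup_act)
  have split: "{1..N} - {i} = {1..<i} \<union> {i<..N}"
    using i by auto
  have left: "?d j + ?s j = (if lookup \<alpha> j < lookup \<alpha> i then ?F else 0) +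
      (if lookup \<alpha> j = lookup \<alpha> i then ?F else 0)" if "j \<in> {1..<i}" for j
  proof -
    have "?s j = ?F" if "lookup \<alpha> j = lookup \<alpha> i"
    proof -
      have "Poly_Mapping.map_key (Transposition.transpose i j) \<alpha> = \<alpha>"
        by (rule poly_mapping_eqI) (use that in \<open>auto simp: lookup_map_key Transposition.transpose_def\<close>)
      then show ?thesis
        by simp
    qed
    moreover have "?s j = 0" if "lookup \<alpha> i < lookup \<alpha> j"
      using sorted [of j i] i that \<open>j \<in> {1..<i}\<close> by (simp add: transpose_commute)
    ultimately show ?thesis
      using linorder_less_linear [of "lookup \<alpha> j" "lookup \<alpha> i"] by auto
  qed
  have right: "?d j = (if lookup \<alpha> j < lookup \<alpha> i then ?F else 0)" if "j \<in> {i<..N}" for j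
    using sorted [of i j] i that by auto
  have "(\<Sum>j \<in> {1..N} - {i}. ?d j) + c * ?F =
      (\<Sum>j \<in> {1..<i}. ?d j + ?s j) + (\<Sum>j \<in> {i<..N}. ?d j)"
    unfolding c split by (subst sum.union_disjoint) (auto simp: sum.distrib)
  also have "\<dots> = (\<Sum>j \<in> {1..<i}. (if lookup \<alpha> j < lookup \<alpha> i then ?F else 0)) +
      (\<Sum>j \<in> {i<..N}. (if lookup \<alpha> j < lookup \<alpha> i then ?F else 0)) +
      (\<Sum>j \<in> {1..<i}. (if lookup \<alpha> j = lookup \<alpha> i then ?F else 0))"
    using sum.cong [OF refl left, of "{1..<i}"] sum.cong [OF refl right, of "{i<..N}"]
    by (simp only: sum.distrib)
  also have "(\<Sum>j \<in> {1..<i}. (if lookup \<alpha> j < lookup \<alpha> i then ?F else 0)) +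
      (\<Sum>j \<in> {i<..N}. (if lookup \<alpha> j < lookup \<alpha> i then ?F else 0)) =
      (\<Sum>j \<in> {1..N} - {i}. (if lookup \<alpha> j < lookup \<alpha> i then ?F else 0))"
    unfolding split by (subst sum.union_disjoint) auto
  also have "\<dots> = (\<Sum>j \<in> {1..N}. (if lookup \<alpha> j < lookup \<alpha> i then ?F else 0))"
    by (rule sum.mono_neutral_left) auto
  also have "\<dots> = of_nat (count_below N \<alpha> (lookup \<alpha> i)) * ?F"
    by (simp add: count_below_def flip: sum.inter_filter)
  also have "(\<Sum>j \<in> {1..<i}. (if lookup \<alpha> j = lookup \<alpha> i then ?F else 0)) =
      of_nat (card {j \<in> {1..<i}. lookup \<alpha> j = lookup \<alpha> i}) * ?F"
    by (simp flip: sum.inter_filter)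
  finally have "(\<Sum>j \<in> {1..N} - {i}. ?d j) + c * ?F = of_nat (rank N \<alpha> i) * ?F"
    by (simp add: rank_def algebra_simps)
  then have d: "(\<Sum>j \<in> {1..N} - {i}. ?d j) = (of_nat (rank N \<alpha> i) - c) * ?F"
    by (simp add: algebra_simps)
  have "of_nat (lookup \<alpha> i) * ?F + \<kappa> * (\<Sum>j \<in> {1..N} - {i}. ?d j) = 0"
    by (rule dunkl_kernel_extremal [OF dunkl i top])
  then have "(of_nat (lookup \<alpha> i) + \<kappa> * (of_nat (rank N \<alpha> i) - c)) * ?F = 0"
    unfolding d by (simp add: algebra_simps)
  then have "of_nat (lookup \<alpha> i) + \<kappa> * (of_nat (rank N \<alpha> i) - c) = 0"
    using nz by (simp only: mult_eq_0_iff simp_thms)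
  then show ?thesis
    by (simp add: algebra_simps)
qed

section \<open>Reading order of Young diagrams\<close>

text \<open>Rows and columns enter alike, so that the transposed diagram is covered by the same
  lemmas.\<close>

definition young :: "(nat \<times> nat) set \<Rightarrow> bool" where
  "young D \<longleftrightarrow> finite D \<and> (\<forall>r c r' c'. (r, c) \<in> D \<longrightarrow> r' \<le> r \<longrightarrow> c' \<le> c \<longrightarrow> (r', c') \<in> D)"

lemma youngD: "young D \<Longrightarrow> (r, c) \<in> D \<Longrightarrow> r' \<le> r \<Longrightarrow> c' \<le> c \<Longrightarrow> (r', c') \<in> D"
  unfolding young_def by blast

lemma young_finite: "young D \<Longrightarrow> finite D"
  by (simp add: young_def)

definition content :: "nat \<times> nat \<Rightarrow> int" where
  "content x = int (snd x) - int (fst x)"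

text \<open>On cells the order is lexicographic, so a diagram is listed row by row, and its
  transpose yields the listing column by column.\<close>

definition position :: "'a::linorder set \<Rightarrow> 'a \<Rightarrow> nat" where
  "position D x = card {y \<in> D. y < x}"

lemma position_less: "finite D \<Longrightarrow> x \<in> D \<Longrightarrow> x < y \<Longrightarrow> position D x < position D y"
  unfolding position_def by (rule psubset_card_mono) auto

lemma position_less_iff:
  "finite D \<Longrightarrow> x \<in> D \<Longrightarrow> y \<in> D \<Longrightarrow> position D x < position D y \<longleftrightarrow> x < y"
  by (metis position_less less_asym linorder_neqE)

lemma bij_betw_position:
  assumes "finite D"
  shows "bij_betw (position D) D {..<card D}"
proof -
  have inj: "inj_on (position D) D"
    by (rule inj_onI) (metis assms position_less less_irrefl linorder_neqE)
  have "position D ` D \<subseteq> {..<card D}"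
    unfolding position_def using assms by (auto intro!: psubset_card_mono)
  then have "position D ` D = {..<card D}"
    by (intro card_subset_eq) (simp_all add: card_image inj)
  with inj show ?thesis
    by (simp add: bij_betw_def)
qed

lemma position_Suc_column:
  assumes "young D" "(b, Suc j) \<in> D"
  shows "position D (b, Suc j) = Suc (position D (b, j))"
proof -
  have "{y \<in> D. y < (b, Suc j)} = insert (b, j) {y \<in> D. y < (b, j)}"
    using youngD [OF assms, of b j] by auto
  then show ?thesis
    using young_finite [OF assms(1)] by (simp add: position_def)
qed

text \<open>
  The two enumerations list the same contents.  Once the rows before \<open>b\<close> are listed, the row
  condition makes the next cell a leftmost one, with content at most \<open>- b\<close>, while the column condition
  puts it in row \<open>b\<close>, with content at least \<open>- b\<close>.  After that, the rest of the row is forced, since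
  contents increase by at most one from each cell to the next.
\<close>

lemma enumerations_eq_position:
  assumes young: "young D"
    and bij: "bij_betw p D {..<card D}" "bij_betw q D {..<card D}"
    and same: "\<And>x y. x \<in> D \<Longrightarrow> y \<in> D \<Longrightarrow> p x = q y \<Longrightarrow> content x = content y"
    and row: "\<And>r c. (r, c) \<in> D \<Longrightarrow> (r, Suc c) \<in> D \<Longrightarrow> p (r, c) < p (r, Suc c)"
    and col: "\<And>r c. (r, c) \<in> D \<Longrightarrow> (Suc r, c) \<in> D \<Longrightarrow> q (r, c) < q (Suc r, c)"
    and step: "\<And>x y. x \<in> D \<Longrightarrow> y \<in> D \<Longrightarrow> q y = Suc (q x) \<Longrightarrow> content y \<le> content x + 1"
    and x: "x \<in> D"
  shows "p x = position D x \<and> q x = position D x"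
  using x
proof (induction "position D x" arbitrary: x rule: less_induct)
  case less
  note fin = young_finite [OF young]
  note bijL = bij_betw_position [OF fin]
  obtain b j where x: "x = (b, j)"
    by (cases x)
  let ?s = "position D x"
  have IH: "p y = position D y" "q y = position D y" if "y \<in> D" "y < x" for y
    using less(1) [of y] position_less [OF fin that] that by auto
  have s: "?s < card D"
    using bijL less(2) by (auto simp: bij_betw_def)
  \<comment> \<open>The cells before \<open>x\<close> already take all values below
    \<open>?s\<close>, so by injectivity no other cell does. The function \<open>f\<close> is
    general because the claim is used for both \<open>p\<close> and \<open>q\<close>.\<close>
  have early: "y < x" if "y \<in> D" "f y < ?s" "bij_betw f D {..<card D}"
    "\<And>z. z \<in> D \<Longrightarrow> z < x \<Longrightarrow> f z = position D z" for f :: "nat \<times> nat \<Rightarrow> nat" and y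
  proof -
    have "f y \<in> position D ` D"
      using bijL s that(2) by (auto simp: bij_betw_def)
    then obtain z where z: "z \<in> D" "position D z = f y"
      by auto
    then have "z < x"
      using position_less_iff [OF fin z(1) less(2)] that(2) by simp
    then have "f z = f y"
      using z that(4) by simp
    then have "z = y"
      using that(1,3) z(1) by (auto simp: bij_betw_def inj_on_def)
    with \<open>z < x\<close> show ?thesis
      by simp
  qed
  note earlyp = early [OF _ _ bij(1) IH(1)] and earlyq = early [OF _ _ bij(2) IH(2)]
  have late: "\<not> y < x" if "y \<in> D" "?s \<le> f y" "\<And>z. z \<in> D \<Longrightarrow> z < x \<Longrightarrow> f z = position D z"
    for f :: "nat \<times> nat \<Rightarrow> nat" and y
    using that(2) that(3) [OF that(1)] position_less [OF fin that(1), of x] by linarith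
  obtain y where y: "y \<in> D" "p y = ?s"
    using bij(1) s by (metis bij_betw_def imageE lessThan_iff)
  obtain z where z: "z \<in> D" "q z = ?s"
    using bij(2) s by (metis bij_betw_def imageE lessThan_iff)
  obtain b' c' where y': "y = (b', c')"
    by (cases y)
  obtain r c where z': "z = (r, c)"
    by (cases z)
  have yx: "\<not> y < x" and zx: "\<not> z < x"
    using late [OF y(1) _ IH(1)] late [OF z(1) _ IH(2)] y z by auto
  have left: "(b', k) < x" if "c' = Suc k" for k
  proof -
    have k: "(b', k) \<in> D"
      using youngD [OF young, of b' c' b' k] y(1) that by (simp add: y')
    then have "p (b', k) < ?s"
      using row [of b' k] y that by (simp add: y')
    then show ?thesis
      by (rule earlyp [OF k])
  qed
  have yz: "content y = content z"
    using same y z by simp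
  show ?case
  proof (cases j)
    case 0
    have "c' = 0"
      using left yx by (cases c') (auto simp: x y' 0)
    moreover have "r \<le> b"
    proof (rule ccontr)
      assume "\<not> r \<le> b"
      then obtain k where k: "r = Suc k" "b \<le> k"
        by (cases r) auto
      have "(k, c) < x"
      proof -
        have k': "(k, c) \<in> D"
          using youngD [OF young, of r c k c] z(1) k by (simp add: z')
        then have "q (k, c) < ?s"
          using col [of k c] z k by (simp add: z')
        then show ?thesis
          by (rule earlyq [OF k'])
      qed
      then show False
        using k by (simp add: x 0)
    qed
    ultimately have "y = x" "z = x"
      using yx zx yz by (auto simp: x y' z' 0 content_def)
    then show ?thesis
      using y z by simp
  next
    case (Suc i)
    have prev: "(b, i) \<in> D" "(b, i) < x"
      using less(2) youngD [OF young, of b j b i] by (auto simp: x Suc)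
    have s': "?s = Suc (q (b, i))"
      using position_Suc_column [OF young, of b i] less(2) IH(2) [OF prev] by (simp add: x Suc)
    have "z = x"
    proof -
      \<comment> \<open>Among the cells of row \<open>b\<close> from column \<open>j\<close> on,
        \<open>(b, d)\<close> is to be the one that \<open>q\<close> lists earliest; it will turn
        out to be \<open>x\<close>.\<close>
      have "\<exists>c. (b, c) \<in> D \<and> j \<le> c"
        using less(2) x by blast
      then obtain d where d: "(b, d) \<in> D" "j \<le> d"
        and min: "\<And>e. (b, e) \<in> D \<Longrightarrow> j \<le> e \<Longrightarrow> q (b, d) \<le> q (b, e)"
        using ex_has_least_nat [of "\<lambda>c. (b, c) \<in> D \<and> j \<le> c" _ "\<lambda>c. q (b, c)"] by blast
      have sd: "?s \<le> q (b, d)"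
        using earlyq [OF d(1)] d(2) by (auto simp: x not_less [symmetric])
      \<comment> \<open>Otherwise the cell listed just before \<open>(b, d)\<close> lies in a later
        row, by minimality, and left of column \<open>j\<close>, since else the cell of row
        \<open>b\<close> above it would be listed earlier still. From there to \<open>(b, d)\<close>
        the content would jump by more than one.\<close>
      have "q (b, d) = ?s"
      proof (rule ccontr)
        assume "q (b, d) \<noteq> ?s"
        with sd obtain t where t: "q (b, d) = Suc t" "?s \<le> t"
          by (cases "q (b, d)") auto
        have "t < card D"
          using bij_betwE [OF bij(2)] d(1) t(1) by force
        then obtain u where u: "u \<in> D" "q u = t"
          using bij(2) by (metis bij_betw_def imageE lessThan_iff)
        obtain r' e where u': "u = (r', e)"
          by (cases u)
        have "\<not> u < x"
          using late [OF u(1) _ IH(2)] u t by simp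
        moreover have "r' \<noteq> b \<or> e < j"
        proof (rule ccontr)
          assume "\<not> (r' \<noteq> b \<or> e < j)"
          then have "q (b, d) \<le> t"
            using min [of e] u by (simp add: u')
          then show False
            using t by simp
        qed
        ultimately have "b < r'"
          by (auto simp: u' x)
        moreover have "e < j"
        proof (rule ccontr)
          assume "\<not> e < j"
          then have e: "(k, e) \<in> D" "j \<le> e" if "k \<le> r'" for k
            using youngD [OF young u(1) [unfolded u'], of k e] that by auto
          have "q (b, e) \<le> q (k, e)" if "b \<le> k" "k \<le> r'" for k
            using that
          proof (induction k rule: dec_induct)
            case (step k)
            then show ?case
              using col [of k e] e(1) [of k] e(1) [of "Suc k"] by simp
          qed simp
          from this [of r'] \<open>b < r'\<close> min [of e] e [of b] show False
            using u t by (simp add: u')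
        qed
        moreover have "content (b, d) \<le> content u + 1"
          using step [of u "(b, d)"] u d t by simp
        ultimately show False
          using d(2) by (simp add: content_def u')
      qed
      then have zd: "z = (b, d)"
        using bij(2) z d(1) by (auto simp: bij_betw_def inj_on_def)
      \<comment> \<open>The cell listed just before \<open>z\<close> is \<open>(b, i)\<close>, so
        the bound on content steps leaves only column \<open>j\<close>.\<close>
      then have "content z \<le> content (b, i) + 1"
        using step [OF prev(1) z(1)] z s' by simp
      then show ?thesis
        using d(2) by (simp add: zd x Suc content_def)
    qed
    \<comment> \<open>The cell \<open>y\<close> lies on the diagonal of \<open>x\<close> and not
      before it. A later cell of that diagonal would have its left neighbour after \<open>x\<close>,
      contrary to the row condition.\<close>
    moreover have "y = x"
    proof (cases c')
      case 0
      then show ?thesis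
        using yz \<open>z = x\<close> yx by (simp add: x y' Suc content_def)
    next
      case (Suc k)
      with left [of k] yz \<open>z = x\<close> yx show ?thesis
        by (auto simp: x y' content_def)
    qed
    ultimately show ?thesis
      using y z by simp
  qed
qed

section \<open>Jucys--Murphy eigenvectors\<close>

abbreviation "tr \<equiv> Transposition.transpose"

lemma act_tr_tr [simp]: "act (tr i j) (act (tr i j) f) = f"
  by (simp add: act_act)

lemma act_conj_tr:
  assumes "bij w"
  shows "act w (act (tr i j) f) = act (tr (w i) (w j)) (act w f)"
proof -
  have "w \<circ> tr i j = tr (w i) (w j) \<circ> w"
    using assms by (auto simp: fun_eq_iff Transposition.transpose_def bij_def inj_eq)
  then show ?thesis
    by (simp add: act_act)
qed

lemma sum_const_scale: "(\<Sum>x \<in> A. f) = scale (of_nat (card A)) f"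
  by (induction A rule: infinite_finite_induct) (simp_all add: mpoly.scale_left_distrib del: sum_constant)

text \<open>
  The stabilizer of the line through \<open>v\<close> acts on it by signs.  Averaging over it with these signs
  scales \<open>v\<close> by a positive factor and kills the generators.
\<close>

lemma span_vanishing:
  assumes v: "v \<in> mpoly.span E"
    and E: "\<And>e. e \<in> E \<Longrightarrow> \<exists>i \<in> {1..N}. \<exists>j \<in> {1..N}.
      act (tr i j) v = scale \<epsilon> v \<and> act (tr i j) e = scale (- \<epsilon>) e"
    and \<epsilon>: "\<epsilon> = 1 \<or> \<epsilon> = -1"
  shows "v = 0"
proof (rule ccontr)
  assume "v \<noteq> 0"
  define H where "H = {h. h permutes {1..N} \<and> (\<exists>c. (c = 1 \<or> c = -1) \<and> act h v = scale c v)}"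
  define \<chi> where "\<chi> h = (SOME c. (c = 1 \<or> c = -1) \<and> act h v = scale c v)" for h
  define A where "A u = (\<Sum>h \<in> H. scale (\<chi> h) (act h u))" for u
  have H: "h permutes {1..N}" "\<chi> h = 1 \<or> \<chi> h = -1" "act h v = scale (\<chi> h) v" if "h \<in> H" for h
  proof -
    have "(\<chi> h = 1 \<or> \<chi> h = -1) \<and> act h v = scale (\<chi> h) v"
      unfolding \<chi>_def by (rule someI_ex) (use that in \<open>auto simp: H_def\<close>)
    then show "\<chi> h = 1 \<or> \<chi> h = -1" "act h v = scale (\<chi> h) v"
      by auto
  qed (use that in \<open>simp add: H_def\<close>)
  have "finite H"
    by (rule finite_subset [OF _ finite_permutations [of "{1..N}"]]) (auto simp: H_def)
  have "id \<in> H"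
    by (auto simp: H_def permutes_id intro!: exI [of _ 1])
  have "A e = 0" if e: "e \<in> E" for e
  proof -
    obtain i j where ij: "i \<in> {1..N}" "j \<in> {1..N}" "act (tr i j) v = scale \<epsilon> v"
      "act (tr i j) e = scale (- \<epsilon>) e"
      using E [OF e] by blast
    let ?t = "tr i j"
    have t: "?t permutes {1..N}"
      by (rule permutes_swap_id [OF ij(1,2)])
    have HT: "h \<circ> ?t \<in> H" "\<chi> (h \<circ> ?t) = \<epsilon> * \<chi> h" if h: "h \<in> H" for h
    proof -
      have eq: "act (h \<circ> ?t) v = scale (\<epsilon> * \<chi> h) v"
        using H(3) [OF h] by (simp add: ij(3) act_scale flip: act_act)
      then show "h \<circ> ?t \<in> H"
        using H(1,2) [OF h] \<epsilon> permutes_compose [OF t, of h] by (auto simp: H_def)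
      from H(3) [OF this] eq show "\<chi> (h \<circ> ?t) = \<epsilon> * \<chi> h"
        using \<open>v \<noteq> 0\<close> by (simp add: mpoly.scale_right_imp_eq)
    qed
    \<comment> \<open>Right translation by \<open>?t\<close> permutes \<open>H\<close>. It
      contributes \<epsilon> through \<chi> and -\<epsilon> through \<open>e\<close>, in total the
      factor -1.\<close>
    have "A e = (\<Sum>h \<in> H. scale (\<chi> (h \<circ> ?t)) (act (h \<circ> ?t) e))"
      unfolding A_def
      by (rule sum.reindex_bij_witness [of _ "\<lambda>h. h \<circ> ?t" "\<lambda>h. h \<circ> ?t"])
        (simp_all add: HT comp_assoc)
    also have "\<dots> = (\<Sum>h \<in> H. - scale (\<chi> h) (act h e))"
      by (rule sum.cong) (use \<epsilon> in \<open>auto simp: HT ij(4) act_scale act_uminus simp flip: act_act\<close>)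
    also have "\<dots> = - A e"
      by (simp add: A_def sum_negf)
    finally have "A e = - A e" .
    then have "lookup (A e) \<beta> = - lookup (A e) \<beta>" for \<beta>
      by (metis lookup_uminus)
    then show ?thesis
      by (intro poly_mapping_eqI) simp
  qed
  note AE = this
  have "A (f + g) = A f + A g" "A (scale c f) = scale c (A f)" for f g c
    by (simp_all add: A_def act_add act_scale mpoly.scale_right_distrib sum.distrib
        mpoly.scale_sum_right mult.commute)
  note A_linear = this
  have "A v = 0"
    using v
  proof (induction rule: mpoly.span_induct_alt)
    case base
    show ?case
      by (simp add: A_def)
  qed (simp add: A_linear AE)
  moreover have "A v = (\<Sum>h \<in> H. v)"
    unfolding A_def
  proof (rule sum.cong [OF refl])
    fix h assume "h \<in> H"
    from H(2,3) [OF this] show "scale (\<chi> h) (act h v) = v"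
      by auto
  qed
  moreover note sum_const_scale [of v H]
  ultimately show False
    using \<open>finite H\<close> \<open>id \<in> H\<close> \<open>v \<noteq> 0\<close> by auto
qed

text \<open>If no two elements agreed in color and column, each column would receive at most as many
  elements as it has cells in rows 0 to \<open>b\<close>: a column reaching row \<open>b\<close> is
  limited by the b + 1 colors, a shorter one by its own length. Summing over columns contradicts the
  cardinality.\<close>

lemma column_pigeonhole:
  fixes color :: "'a \<Rightarrow> nat" and cell :: "'a \<Rightarrow> nat \<times> nat"
  assumes young: "young D" and X: "finite X" "\<And>i. i \<in> X \<Longrightarrow> color i \<le> b"
    and cell: "inj_on cell X" "cell ` X \<subseteq> D"
    and card: "card {x \<in> D. fst x \<le> b} < card X"
  obtains i j where "i \<in> X" "j \<in> X" "i \<noteq> j" "color i = color j" "snd (cell i) = snd (cell j)"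
proof (rule ccontr)
  note found = that
  assume "\<not> thesis"
  then have inj: "i = j"
    if "i \<in> X" "j \<in> X" "color i = color j" "snd (cell i) = snd (cell j)" for i j
    using found that by blast
  note fin = young_finite [OF young]
  have "card {i \<in> X. snd (cell i) = \<gamma>} \<le> card {x \<in> {x \<in> D. fst x \<le> b}. snd x = \<gamma>}" for \<gamma>
  proof (cases "(b, \<gamma>) \<in> D")
    case True
    have "card {i \<in> X. snd (cell i) = \<gamma>} \<le> card {..b}"
      by (rule card_inj_on_le [of color]) (use X inj in \<open>auto simp: inj_on_def\<close>)
    also have "\<dots> = card ((\<lambda>r. (r, \<gamma>)) ` {..b})"
      by (subst card_image) (auto simp: inj_on_def)
    also have "\<dots> \<le> card {x \<in> {x \<in> D. fst x \<le> b}. snd x = \<gamma>}"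
      by (rule card_mono) (use fin youngD [OF young True] in auto)
    finally show ?thesis .
  next
    case False
    then have "fst x \<le> b" if "x \<in> D" "snd x = \<gamma>" for x
      using youngD [OF young, of "fst x" "snd x" b \<gamma>] that by fastforce
    then show ?thesis
      by (intro card_inj_on_le [of cell]) (use cell fin in \<open>auto simp: inj_on_def\<close>)
  qed
  then have "(\<Sum>\<gamma> \<in> snd ` D. card {i \<in> X. snd (cell i) = \<gamma>}) \<le>
      (\<Sum>\<gamma> \<in> snd ` D. card {x \<in> {x \<in> D. fst x \<le> b}. snd x = \<gamma>})"
    by (rule sum_mono)
  moreover have "(\<Sum>\<gamma> \<in> snd ` D. card {i \<in> X. snd (cell i) = \<gamma>}) = card X"
    unfolding card_eq_sum by (rule sum.group) (use fin X cell in auto)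
  moreover have "(\<Sum>\<gamma> \<in> snd ` D. card {x \<in> {x \<in> D. fst x \<le> b}. snd x = \<gamma>}) = card {x \<in> D. fst x \<le> b}"
    unfolding card_eq_sum by (rule sum.group) (use fin in auto)
  ultimately show False
    using card by simp
qed

text \<open>Shifted by one, since tableau entries are variable indices from 1 on, while positions
  and ranks start at 0.\<close>

definition reading :: "(nat \<times> nat) set \<Rightarrow> nat \<times> nat \<Rightarrow> nat" where
  "reading D x = Suc (position D x)"

lemma bij_betw_reading:
  assumes "finite D"
  shows "bij_betw (reading D) D {1..card D}"
proof -
  have "bij_betw Suc {..<card D} {1..card D}"
    by (rule bij_betwI [of _ _ _ "\<lambda>i. i - 1"]) auto
  from bij_betw_trans [OF bij_betw_position [OF assms] this] show ?thesis
    by (simp add: reading_def [abs_def] comp_def)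
qed

lemma reading_eq_iff: "finite D \<Longrightarrow> x \<in> D \<Longrightarrow> y \<in> D \<Longrightarrow> reading D x = reading D y \<longleftrightarrow> x = y"
  using bij_betw_reading by (metis bij_betw_imp_inj_on inj_onD)

lemma reading_less_iff:
  "finite D \<Longrightarrow> x \<in> D \<Longrightarrow> y \<in> D \<Longrightarrow> reading D x < reading D y \<longleftrightarrow> x < y"
  by (simp add: reading_def position_less_iff)

lemma reading_in: "finite D \<Longrightarrow> x \<in> D \<Longrightarrow> reading D x \<in> {1..card D}"
  using bij_betw_reading by (metis bij_betwE)

text \<open>The share of one row in a Jucys--Murphy element: if \<open>x\<close> lies below row
  \<open>b\<close>, that entire row precedes it in reading order.\<close>

definition row_sum :: "(nat \<times> nat) set \<Rightarrow> nat \<Rightarrow> nat \<times> nat \<Rightarrow> mpoly \<Rightarrow> mpoly" where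
  "row_sum D b x g = (\<Sum>y \<in> {y \<in> D. fst y = b}. act (tr (reading D x) (reading D y)) g)"

text \<open>Covers two situations: the row vector, with \<epsilon> = 1 and the Specht polynomials as
  \<open>E\<close>, and the column vector over the transposed diagram, with \<epsilon> = -1 and the
  translates of the row vector as \<open>E\<close>. The point is the clash between the symmetry of
  \<open>g\<close> along rows and the opposite symmetry of each generator along the columns of its
  own filling.\<close>

locale line_symmetric =
  fixes D :: "(nat \<times> nat) set" and E :: "mpoly set" and \<epsilon> :: rat and g :: mpoly
  assumes young: "young D"
    and sign: "\<epsilon> = 1 \<or> \<epsilon> = -1"
    and orbit: "\<And>w. w permutes {1..card D} \<Longrightarrow> act w g \<in> mpoly.span E"
    and rows: "\<And>x y. x \<in> D \<Longrightarrow> y \<in> D \<Longrightarrow> x \<noteq> y \<Longrightarrow> fst x = fst y \<Longrightarrow>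
      act (tr (reading D x) (reading D y)) g = scale \<epsilon> g"
    and columns: "\<And>e. e \<in> E \<Longrightarrow> \<exists>T. bij_betw T D {1..card D} \<and>
      (\<forall>x \<in> D. \<forall>y \<in> D. x \<noteq> y \<longrightarrow> snd x = snd y \<longrightarrow> act (tr (T x) (T y)) e = scale (- \<epsilon>) e)"
begin

lemmas fin = young_finite [OF young]

lemma sign_sq: "\<epsilon> * \<epsilon> = 1"
  using sign by auto

text \<open>Adding \<epsilon> times the row sum to \<open>g\<close> extends its \<epsilon>-symmetry
  from row \<open>b\<close> to that row together with the label of \<open>x\<close>, as a signed sum
  over coset representatives. This is one label too many for rows 0 to \<open>b\<close>: against
  every generator the pigeonhole principle finds a pair with opposite symmetries, so the sum
  vanishes.\<close>

lemma row_sum_later: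
  assumes x: "x \<in> D" and b: "b < fst x"
  shows "row_sum D b x g = scale (- \<epsilon>) g"
proof -
  let ?T = "reading D" and ?R = "{y \<in> D. fst y = b}" and ?N = "card D"
  define k where "k = ?T x"
  define v where "v = g + scale \<epsilon> (row_sum D b x g)"
  have k: "k \<in> {1..?N}"
    using reading_in [OF fin x] by (simp add: k_def)
  have kR: "?T y \<noteq> k" if "y \<in> D" "fst y \<le> b" for y
    using that x b by (auto simp: k_def reading_eq_iff fin)
  have swap: "act (tr k j) g \<in> mpoly.span E" if "j \<in> {1..?N}" for j
    by (intro orbit permutes_swap_id k that)
  have "v \<in> mpoly.span E"
    unfolding v_def row_sum_def k_def [symmetric]
    by (intro mpoly.span_add mpoly.span_scale mpoly.span_sum swap)
      (use orbit [of id] reading_in [OF fin] in \<open>auto simp: permutes_id\<close>)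
  have fix1: "act (tr (?T y) (?T z)) v = scale \<epsilon> v"
    if yz: "y \<in> D" "z \<in> D" "y \<noteq> z" "fst y = fst z" "fst y \<le> b" for y z
  proof -
    let ?t = "tr (?T y) (?T z)"
    have tk: "?t k = k"
      using kR [of y] kR [of z] yz by (simp add: transpose_apply_other)
    have t: "act ?t (act (tr k (?T u)) g) = scale \<epsilon> (act (tr k (?T (tr y z u))) g)" if "u \<in> ?R" for u
    proof -
      have "?t (?T u) = ?T (tr y z u)"
        using that yz fin by (auto simp: Transposition.transpose_def reading_eq_iff)
      then show ?thesis
        using act_conj_tr [of ?t k "?T u" g] rows [OF yz(1-4)] by (simp add: tk act_scale)
    qed
    have "act ?t (row_sum D b x g) = (\<Sum>u \<in> ?R. scale \<epsilon> (act (tr k (?T (tr y z u))) g))"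
      by (simp add: row_sum_def act_sum t flip: k_def)
    also have "\<dots> = (\<Sum>u \<in> ?R. scale \<epsilon> (act (tr k (?T u)) g))"
      by (rule sum.reindex_bij_witness [of _ "tr y z" "tr y z"])
        (use yz in \<open>auto simp: Transposition.transpose_def\<close>)
    also have "\<dots> = scale \<epsilon> (row_sum D b x g)"
      by (simp add: row_sum_def mpoly.scale_sum_right flip: k_def)
    finally show ?thesis
      by (simp add: v_def act_add act_scale rows [OF yz(1-4)] mpoly.scale_right_distrib)
  qed
  have fix2: "act (tr k (?T y)) v = scale \<epsilon> v" if y: "y \<in> ?R" for y
  proof -
    \<comment> \<open>In terms of labels, (k y)(k u) = (k u)(u y), and (u y) acts on
      \<open>g\<close> by \<epsilon>. The case u = y is kept apart because there the transposition
      exchanges the summands \<open>g\<close> and (k y) \<open>g\<close>, up to \<epsilon>.\<close>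
    have eq: "act (tr k (?T y)) (act (tr k (?T u)) g) = scale \<epsilon> (act (tr k (?T u)) g)"
      if "u \<in> ?R - {y}" for u
    proof -
      have "tr k (?T y) \<circ> tr k (?T u) = tr k (?T u) \<circ> tr (?T u) (?T y)"
        using kR [of y] kR [of u] y that fin
        by (auto simp: fun_eq_iff Transposition.transpose_def reading_eq_iff)
      moreover have "act (tr (?T u) (?T y)) g = scale \<epsilon> g"
        by (rule rows) (use y that in auto)
      ultimately show ?thesis
        by (metis act_act act_scale)
    qed
    define S where "S = (\<Sum>u \<in> ?R - {y}. act (tr k (?T u)) g)"
    have split: "row_sum D b x g = act (tr k (?T y)) g + S"
      unfolding row_sum_def k_def [symmetric] S_def
      by (rule sum.remove) (use fin y in auto)
    have "act (tr k (?T y)) S = scale \<epsilon> S"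
      by (simp only: S_def act_sum mpoly.scale_sum_right sum.cong [OF refl eq])
    then show ?thesis
      by (simp add: v_def split act_add act_scale mpoly.scale_right_distrib sign_sq)
  qed
  have "v = 0"
  proof (rule span_vanishing [OF \<open>v \<in> mpoly.span E\<close> _ sign, of ?N])
    fix e assume "e \<in> E"
    then obtain T where T: "bij_betw T D {1..?N}"
      and Te: "\<And>x y. x \<in> D \<Longrightarrow> y \<in> D \<Longrightarrow> x \<noteq> y \<Longrightarrow> snd x = snd y \<Longrightarrow> act (tr (T x) (T y)) e = scale (- \<epsilon>) e"
      using columns by metis
    let ?Y = "{y \<in> D. fst y \<le> b}"
    let ?X = "insert k (?T ` ?Y)" and ?cell = "inv_into D T"
    define color where "color i = (if i = k then b else fst (inv_into D ?T i))" for i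
    have colT: "color (?T y) = fst y" if "y \<in> D" "fst y \<le> b" for y
      using kR [OF that] that bij_betw_inv_into_left [OF bij_betw_reading [OF fin]]
      by (simp add: color_def)
    have X: "?X \<subseteq> {1..?N}"
      using k reading_in [OF fin] by auto
    have cell: "?cell i \<in> D" "T (?cell i) = i" if "i \<in> ?X" for i
      using that X bij_betw_inv_into_right [OF T] bij_betwE [OF bij_betw_inv_into [OF T]] by blast+
    have "inj_on ?T ?Y"
      using fin by (auto simp: inj_on_def reading_eq_iff)
    then have "card ?X = Suc (card ?Y)"
      using kR fin by (subst card_insert_disjoint) (auto simp: card_image)
    then have card: "card ?Y < card ?X"
      by simp
    have color: "color i \<le> b" if "i \<in> ?X" for i
    proof (cases "i = k")
      case False
      then obtain y where "y \<in> ?Y" "i = ?T y"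
        using \<open>i \<in> ?X\<close> by auto
      then show ?thesis
        using colT [of y] by simp
    qed (simp add: color_def)
    have inj: "inj_on ?cell ?X"
      using cell(2) by (rule inj_on_inverseI)
    have im: "?cell ` ?X \<subseteq> D"
      using cell(1) by blast
    have "finite ?X"
      using fin by simp
    obtain i j where ij: "i \<in> ?X" "j \<in> ?X" "i \<noteq> j" "color i = color j" "snd (?cell i) = snd (?cell j)"
      by (rule column_pigeonhole [OF young \<open>finite ?X\<close> color inj im card])
    have "act (tr i j) v = scale \<epsilon> v"
    proof (cases "i = k \<or> j = k")
      case True
      have "\<exists>y \<in> ?R. i = k \<and> j = ?T y \<or> j = k \<and> i = ?T y"
      proof (cases "i = k")
        case True
        then obtain y where "y \<in> ?Y" "j = ?T y"
          using ij by auto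
        moreover have "fst y = b"
          using ij(4) colT [of y] calculation True by (simp add: color_def [of k])
        ultimately show ?thesis
          using True by (intro bexI [of _ y]) auto
      next
        case False
        with \<open>i = k \<or> j = k\<close> ij obtain y where "j = k" "y \<in> ?Y" "i = ?T y"
          by auto
        moreover have "fst y = b"
          using ij(4) colT [of y] calculation by (simp add: color_def [of k])
        ultimately show ?thesis
          by (intro bexI [of _ y]) auto
      qed
      then show ?thesis
        using fix2 by (auto simp: transpose_commute)
    next
      case False
      then obtain y z where "y \<in> ?Y" "z \<in> ?Y" "i = ?T y" "j = ?T z"
        using ij by auto
      then show ?thesis
        using ij fix1 [of y z] by (auto simp: colT)
    qed
    moreover have "act (tr i j) e = scale (- \<epsilon>) e"
      using Te [of "?cell i" "?cell j"] cell ij by metis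
    ultimately show "\<exists>i \<in> {1..?N}. \<exists>j \<in> {1..?N}.
        act (tr i j) v = scale \<epsilon> v \<and> act (tr i j) e = scale (- \<epsilon>) e"
      using X ij(1,2) by blast
  qed
  then have "scale \<epsilon> (row_sum D b x g) = - g"
    by (simp add: v_def eq_neg_iff_add_eq_0 add.commute)
  then have "scale \<epsilon> (scale \<epsilon> (row_sum D b x g)) = scale (- \<epsilon>) g"
    by simp
  then show ?thesis
    by (simp add: sign_sq)
qed

text \<open>In reading order, the labels before that of (r, c) are those of r complete rows, each
  row worth -\<epsilon>, and of the c cells to the left, each cell worth \<epsilon>.\<close>

lemma murphy_eigenvector:
  assumes x: "x \<in> D"
  shows "(\<Sum>j \<in> {1..<reading D x}. act (tr (reading D x) j) g) = scale (\<epsilon> * of_int (content x)) g"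
proof -
  obtain r c where rc: "x = (r, c)"
    by (cases x)
  let ?h = "\<lambda>y. act (tr (reading D x) (reading D y)) g"
  have less: "{y \<in> D. y < x} = (\<Union>b \<in> {..<r}. {y \<in> D. fst y = b}) \<union> Pair r ` {..<c}"
    using x youngD [OF young, of r c r] by (auto simp: rc)
  have "{1..<reading D x} = reading D ` {y \<in> D. y < x}"
  proof (intro equalityI subsetI)
    fix j assume j: "j \<in> {1..<reading D x}"
    then have "j \<in> {1..card D}"
      using reading_in [OF fin x] by auto
    then obtain y where "y \<in> D" "j = reading D y"
      using bij_betw_reading [OF fin] by (metis bij_betw_def imageE)
    then show "j \<in> reading D ` {y \<in> D. y < x}"
      using j reading_less_iff [OF fin _ x] by auto
  next
    fix j assume "j \<in> reading D ` {y \<in> D. y < x}"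
    then show "j \<in> {1..<reading D x}"
      using reading_less_iff [OF fin _ x] reading_in [OF fin] by auto
  qed
  then have "(\<Sum>j \<in> {1..<reading D x}. act (tr (reading D x) j) g) = (\<Sum>y \<in> {y \<in> D. y < x}. ?h y)"
    by (subst sum.reindex [symmetric, unfolded comp_def])
      (auto simp: inj_on_def reading_eq_iff fin)
  also have "\<dots> = (\<Sum>y \<in> (\<Union>b \<in> {..<r}. {y \<in> D. fst y = b}). ?h y) + (\<Sum>y \<in> Pair r ` {..<c}. ?h y)"
    unfolding less by (rule sum.union_disjoint) (use fin in auto)
  also have "(\<Sum>y \<in> (\<Union>b \<in> {..<r}. {y \<in> D. fst y = b}). ?h y) = (\<Sum>b<r. row_sum D b x g)"
    unfolding row_sum_def by (rule sum.UNION_disjoint) (use fin in auto)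
  also have "\<dots> = (\<Sum>b<r. scale (- \<epsilon>) g)"
    by (rule sum.cong) (use row_sum_later [OF x] rc in auto)
  also have "(\<Sum>y \<in> Pair r ` {..<c}. ?h y) = (\<Sum>y \<in> Pair r ` {..<c}. scale \<epsilon> g)"
    by (rule sum.cong [OF refl], rule rows) (use x youngD [OF young, of r c r] rc in auto)
  also have "\<dots> = (\<Sum>d<c. scale \<epsilon> g)"
    by (subst sum.reindex) (auto simp: inj_on_def)
  also have "(\<Sum>b<r. scale (- \<epsilon>) g) + (\<Sum>d<c. scale \<epsilon> g) = scale (\<epsilon> * of_int (content x)) g"
    by (simp add: sum_const_scale rc content_def algebra_simps flip: mpoly.scale_left_diff_distrib
        del: sum_constant)
  finally show ?thesis .
qed

end

section \<open>Row and column vectors of Specht modules\<close>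

lemma young_diagram:
  assumes "is_partition \<tau> N"
  shows "young (diagram \<tau>)"
proof -
  have "diagram \<tau> = (SIGMA r:{..<length \<tau>}. {..<\<tau> ! r})"
    by (auto simp: diagram_def)
  moreover have "\<tau> ! r \<le> \<tau> ! r'" if "r' \<le> r" "r < length \<tau>" for r r'
    using assms that sorted_wrt_nth_less [of "(\<ge>)" \<tau> r' r] by (cases "r' = r") (auto simp: is_partition_def)
  ultimately show ?thesis
    by (fastforce simp: young_def intro: order.strict_trans1 order.strict_trans2)
qed

lemma card_diagram:
  assumes "is_partition \<tau> N"
  shows "card (diagram \<tau>) = N"
proof -
  have "diagram \<tau> = (SIGMA r:{..<length \<tau>}. {..<\<tau> ! r})"
    by (auto simp: diagram_def)
  then show ?thesis
    using assms by (simp add: is_partition_def sum_list_sum_nth atLeast0LessThan)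
qed

section \<open>Specht polynomials and their antisymmetry along columns\<close>

lemma act_specht_poly: "act w (specht_poly \<tau> T) = specht_poly \<tau> (w \<circ> T)"
  unfolding specht_poly_def act_prod
  by (rule prod.cong) (auto simp: act_diff act_var)

lemma finite_column_pairs:
  assumes "finite (diagram \<tau>)"
  shows "finite {(r, s, c). r < s \<and> (r, c) \<in> diagram \<tau> \<and> (s, c) \<in> diagram \<tau>}"
proof (rule finite_subset)
  show "finite (fst ` diagram \<tau> \<times> fst ` diagram \<tau> \<times> snd ` diagram \<tau>)"
    using assms by simp
  show "{(r, s, c). r < s \<and> (r, c) \<in> diagram \<tau> \<and> (s, c) \<in> diagram \<tau>} \<subseteq>
      fst ` diagram \<tau> \<times> fst ` diagram \<tau> \<times> snd ` diagram \<tau>"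
    by force
qed

text \<open>Exchanging vertically adjacent cells preserves the vertical order of every other pair in
  the column, so the other factors are permuted without sign changes and only the factor of the
  exchanged pair is negated.\<close>

lemma act_specht_poly_adjacent:
  assumes fin: "finite (diagram \<tau>)" and inj: "inj_on T (diagram \<tau>)"
    and cells: "(r, c) \<in> diagram \<tau>" "(Suc r, c) \<in> diagram \<tau>"
  shows "act (tr (T (r, c)) (T (Suc r, c))) (specht_poly \<tau> T) = - specht_poly \<tau> T"
proof -
  let ?D = "diagram \<tau>" and ?t = "tr (T (r, c)) (T (Suc r, c))"
  let ?P = "{(r, s, c). r < s \<and> (r, c) \<in> ?D \<and> (s, c) \<in> ?D}"
  let ?h = "\<lambda>(r, s, c). var (T (r, c)) - var (T (s, c))"
  define \<sigma> where "\<sigma> q d = (if d = c then tr r (Suc r) q else q)" for q d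
  have \<sigma>D: "(\<sigma> q d, d) \<in> ?D" if "(q, d) \<in> ?D" for q d
    using that cells by (auto simp: \<sigma>_def Transposition.transpose_def)
  have \<sigma>\<sigma>: "\<sigma> (\<sigma> q d) d = q" for q d
    by (simp add: \<sigma>_def)
  have tT: "?t (T (q, d)) = T (\<sigma> q d, d)" if "(q, d) \<in> ?D" for q d
    using inj_on_eq_iff [OF inj that cells(1)] inj_on_eq_iff [OF inj that cells(2)]
    by (auto simp: \<sigma>_def Transposition.transpose_def)
  have rest: "(\<Prod>x \<in> ?P - {(r, Suc r, c)}. case x of (q, s, d) \<Rightarrow> var (?t (T (q, d))) - var (?t (T (s, d)))) =
      (\<Prod>x \<in> ?P - {(r, Suc r, c)}. ?h x)"
  proof (rule prod.reindex_bij_witness [of _ "\<lambda>(q, s, d). (\<sigma> q d, \<sigma> s d, d)" "\<lambda>(q, s, d). (\<sigma> q d, \<sigma> s d, d)"])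
    fix x assume x: "x \<in> ?P - {(r, Suc r, c)}"
    obtain q s d where qsd: "x = (q, s, d)"
      by (cases x)
    have "\<sigma> q d < \<sigma> s d" "\<not> (\<sigma> q d = r \<and> \<sigma> s d = Suc r \<and> d = c)"
      using x by (auto simp: qsd \<sigma>_def Transposition.transpose_def)
    then show "(\<lambda>(q, s, d). (\<sigma> q d, \<sigma> s d, d)) x \<in> ?P - {(r, Suc r, c)}"
      using x by (auto simp: qsd \<sigma>D)
    then show "(\<lambda>(q, s, d). (\<sigma> q d, \<sigma> s d, d)) x \<in> ?P - {(r, Suc r, c)}" .
    show "?h ((\<lambda>(q, s, d). (\<sigma> q d, \<sigma> s d, d)) x) =
        (case x of (q, s, d) \<Rightarrow> var (?t (T (q, d))) - var (?t (T (s, d))))"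
      using x by (auto simp: qsd tT)
  qed (auto simp: \<sigma>\<sigma>)
  have mem: "(r, Suc r, c) \<in> ?P"
    using cells by simp
  have "act ?t (specht_poly \<tau> T) =
      (\<Prod>x \<in> ?P. case x of (q, s, d) \<Rightarrow> var (?t (T (q, d))) - var (?t (T (s, d))))"
    unfolding act_specht_poly by (simp add: specht_poly_def)
  also have "\<dots> = (var (T (Suc r, c)) - var (T (r, c))) * (\<Prod>x \<in> ?P - {(r, Suc r, c)}. ?h x)"
    by (subst prod.remove [OF finite_column_pairs [OF fin] mem]) (simp add: rest)
  also have "\<dots> = - specht_poly \<tau> T"
    unfolding specht_poly_def
    by (subst prod.remove [OF finite_column_pairs [OF fin] mem]) (simp add: algebra_simps)
  finally show ?thesis .
qed

text \<open>By induction on the lower row: conjugation with an adjacent swap moves the lower cell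
  down by one, and the sign of that swap enters twice.\<close>

lemma act_specht_poly_column:
  assumes young: "young (diagram \<tau>)" and inj: "inj_on T (diagram \<tau>)"
    and x: "x \<in> diagram \<tau>" and y: "y \<in> diagram \<tau>" and xy: "x \<noteq> y" "snd x = snd y"
  shows "act (tr (T x) (T y)) (specht_poly \<tau> T) = - specht_poly \<tau> T"
proof -
  let ?D = "diagram \<tau>" and ?e = "specht_poly \<tau> T"
  have *: "act (tr (T (r, c)) (T (s, c))) ?e = - ?e" if "r < s" "(s, c) \<in> ?D" for r s c
    using that
  proof (induction s)
    case (Suc s)
    have D: "(r, c) \<in> ?D" "(s, c) \<in> ?D"
      using youngD [OF young Suc.prems(2)] Suc.prems(1) by auto
    note adj = act_specht_poly_adjacent [OF young_finite [OF young] inj D(2) Suc.prems(2)]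
    show ?case
    proof (cases "r = s")
      case True
      with adj show ?thesis
        by simp
    next
      case False
      let ?u = "tr (T (s, c)) (T (Suc s, c))"
      have "T (r, c) \<noteq> T (s, c)" "T (r, c) \<noteq> T (Suc s, c)"
        using False Suc.prems(1) inj_on_eq_iff [OF inj D] inj_on_eq_iff [OF inj D(1) Suc.prems(2)] by auto
      then have "act ?u (act (tr (T (r, c)) (T (s, c))) ?e) = act (tr (T (r, c)) (T (Suc s, c))) (act ?u ?e)"
        using act_conj_tr [of ?u "T (r, c)" "T (s, c)" ?e] by (simp add: transpose_apply_other)
      with Suc.IH False Suc.prems(1) D show ?thesis
        by (simp add: adj act_uminus) (metis minus_minus)
    qed
  qed simp
  obtain r s c where rs: "x = (r, c)" "y = (s, c)"
    using xy(2) by (cases x; cases y) auto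
  show ?thesis
  proof (cases r s rule: linorder_cases)
    case less
    then show ?thesis
      using * [of r s c] y by (simp add: rs)
  next
    case greater
    then show ?thesis
      using * [of s r c] x by (simp add: rs transpose_commute)
  qed (use xy(1) rs in simp)
qed

text \<open>The row symmetrization of a Specht polynomial. Outside 1 to \<open>N\<close> the value
  of \<open>row\<close> is unspecified, which is harmless because \<open>w\<close> fixes those
  indices.\<close>

definition row_vector :: "nat \<Rightarrow> nat list \<Rightarrow> mpoly" where
  "row_vector N \<tau> = (let D = diagram \<tau>; row = (\<lambda>i. fst (inv_into D (reading D) i)) in
     \<Sum>w \<in> {w. w permutes {1..N} \<and> row \<circ> w = row}. act w (specht_poly \<tau> (reading D)))"

text \<open>The tableau is numbered down the columns, by way of the transposed diagram. Antisymmetry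
  along columns is built into its Specht polynomial.\<close>

definition column_vector :: "nat list \<Rightarrow> mpoly" where
  "column_vector \<tau> = specht_poly \<tau> (reading (prod.swap ` diagram \<tau>) \<circ> prod.swap)"

lemma row_vector_row:
  assumes part: "is_partition \<tau> N"
    and x: "x \<in> diagram \<tau>" and y: "y \<in> diagram \<tau>" and xy: "fst x = fst y"
  shows "act (tr (reading (diagram \<tau>) x) (reading (diagram \<tau>) y)) (row_vector N \<tau>) = row_vector N \<tau>"
proof -
  let ?D = "diagram \<tau>"
  let ?t = "tr (reading ?D x) (reading ?D y)" and ?row = "\<lambda>i. fst (inv_into ?D (reading ?D) i)"
  let ?G = "{w. w permutes {1..N} \<and> ?row \<circ> w = ?row}"
  note fin = young_finite [OF young_diagram [OF part]]
  have t: "?t permutes {1..N}"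
    using reading_in [OF fin] x y by (intro permutes_swap_id) (auto simp: card_diagram [OF part])
  have "?row (reading ?D x) = ?row (reading ?D y)"
    using bij_betw_inv_into_left [OF bij_betw_reading [OF fin]] x y xy by simp
  then have row: "?row \<circ> ?t = ?row"
    by (auto simp: fun_eq_iff Transposition.transpose_def)
  have G: "?t \<circ> w \<in> ?G" if "w \<in> ?G" for w
    using that t row by (auto simp: permutes_compose fun_eq_iff)
  have "act ?t (row_vector N \<tau>) = (\<Sum>w \<in> ?G. act (?t \<circ> w) (specht_poly \<tau> (reading ?D)))"
    by (simp add: row_vector_def Let_def act_sum act_act)
  also have "\<dots> = (\<Sum>w \<in> ?G. act w (specht_poly \<tau> (reading ?D)))"
    by (rule sum.reindex_bij_witness [of _ "\<lambda>w. ?t \<circ> w" "\<lambda>w. ?t \<circ> w"])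
      (use G in \<open>auto simp: fun_eq_iff\<close>)
  finally show ?thesis
    by (simp add: row_vector_def Let_def)
qed

text \<open>Replacing each variable by one named after its row makes all terms of the symmetrization
  equal; what remains is their number times a product of differences of distinct variables.\<close>

lemma row_vector_nonzero:
  assumes part: "is_partition \<tau> N"
  shows "row_vector N \<tau> \<noteq> 0"
proof -
  let ?D = "diagram \<tau>"
  let ?row = "\<lambda>i. fst (inv_into ?D (reading ?D) i)"
  let ?G = "{w. w permutes {1..N} \<and> ?row \<circ> w = ?row}" and ?s = "\<lambda>i. var (?row i)"
  let ?e = "specht_poly \<tau> (reading ?D)"
  let ?P = "{(r, s, c). r < s \<and> (r, c) \<in> ?D \<and> (s, c) \<in> ?D}"
  note fin = young_finite [OF young_diagram [OF part]]
  have "subst ?s (act w ?e) = subst ?s ?e" if "w \<in> ?G" for w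
  proof -
    have "?row (w i) = ?row i" for i
      using that by (simp add: fun_eq_iff)
    then show ?thesis
      by (simp add: subst_act comp_def)
  qed
  then have "subst ?s (row_vector N \<tau>) = of_nat (card ?G) * subst ?s ?e"
    by (simp add: row_vector_def Let_def subst_sum)
  moreover have "subst ?s ?e = (\<Prod>(r, s, c) \<in> ?P. var r - var s)"
    unfolding specht_poly_def subst_prod
    by (rule prod.cong)
      (auto simp: subst_diff bij_betw_inv_into_left [OF bij_betw_reading [OF fin]])
  then have "subst ?s ?e \<noteq> 0"
    using finite_column_pairs [OF fin] by (auto simp: prod_zero_iff var_eq_iff)
  moreover have "finite ?G" "id \<in> ?G"
    by (auto intro: finite_subset [OF _ finite_permutations [of "{1..N}"]] simp: permutes_id)
  then have "card ?G \<noteq> 0"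
    by (metis (no_types, lifting) card_eq_0_iff empty_iff)
  ultimately have "subst ?s (row_vector N \<tau>) \<noteq> 0"
    by simp
  then show ?thesis
    by auto
qed

lemma specht_poly_nonzero:
  assumes "finite (diagram \<tau>)" "inj_on T (diagram \<tau>)"
  shows "specht_poly \<tau> T \<noteq> 0"
  unfolding specht_poly_def
  using finite_column_pairs [OF assms(1)] assms(2)
  by (auto simp: prod_zero_iff var_eq_iff dest: inj_onD)

lemma young_swap: "young D \<Longrightarrow> young (prod.swap ` D)"
  unfolding young_def by (auto simp: image_iff) (metis swap_simp)

lemma is_tableau_comp: "is_tableau N \<tau> T \<Longrightarrow> w permutes {1..N} \<Longrightarrow> is_tableau N \<tau> (w \<circ> T)"
  unfolding is_tableau_def by (blast intro: bij_betw_trans permutes_imp_bij)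

lemma act_specht_module:
  assumes "f \<in> specht_module N \<tau>" "w permutes {1..N}"
  shows "act w f \<in> specht_module N \<tau>"
  using assms(1) unfolding specht_module_def
proof (induction rule: mpoly.span_induct_alt)
  case base
  show ?case
    by (simp add: mpoly.span_zero)
next
  case (step c e g)
  then have "act w e \<in> specht_poly \<tau> ` {T. is_tableau N \<tau> T}"
    using is_tableau_comp [OF _ assms(2)] by (auto simp: act_specht_poly)
  with step show ?case
    unfolding act_add act_scale by (metis mpoly.span_add mpoly.span_base mpoly.span_scale)
qed

lemma is_tableau_reading:
  assumes "is_partition \<tau> N"
  shows "is_tableau N \<tau> (reading (diagram \<tau>))"
  using bij_betw_reading [OF young_finite [OF young_diagram [OF assms]]]
  by (simp add: is_tableau_def card_diagram [OF assms])

lemma is_tableau_reading_swap: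
  assumes "is_partition \<tau> N"
  shows "is_tableau N \<tau> (reading (prod.swap ` diagram \<tau>) \<circ> prod.swap)"
proof -
  have "card (prod.swap ` diagram \<tau>) = N"
    using card_diagram [OF assms] by (simp add: card_image)
  then have "bij_betw (reading (prod.swap ` diagram \<tau>)) (prod.swap ` diagram \<tau>) {1..N}"
    using bij_betw_reading [of "prod.swap ` diagram \<tau>"] young_finite [OF young_diagram [OF assms]]
    by simp
  moreover have "bij_betw prod.swap (diagram \<tau>) (prod.swap ` diagram \<tau>)"
    by (simp add: bij_betw_def)
  ultimately show ?thesis
    unfolding is_tableau_def by (metis bij_betw_trans)
qed

lemma specht_poly_in: "is_tableau N \<tau> T \<Longrightarrow> specht_poly \<tau> T \<in> specht_module N \<tau>"
  by (simp add: specht_module_def mpoly.span_base)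

lemma row_vector_in:
  assumes "is_partition \<tau> N"
  shows "row_vector N \<tau> \<in> specht_module N \<tau>"
proof -
  have "act w (specht_poly \<tau> (reading (diagram \<tau>))) \<in> specht_module N \<tau>" if "w permutes {1..N}" for w
    using that by (intro act_specht_module specht_poly_in is_tableau_reading assms)
  then show ?thesis
    unfolding row_vector_def Let_def specht_module_def by (intro mpoly.span_sum) blast
qed

lemma column_vector_in: "is_partition \<tau> N \<Longrightarrow> column_vector \<tau> \<in> specht_module N \<tau>"
  unfolding column_vector_def by (intro specht_poly_in is_tableau_reading_swap)

section \<open>Jucys--Murphy eigenvalues of the row and column vectors\<close>

lemma row_vector_murphy:
  assumes part: "is_partition \<tau> N" and x: "x \<in> diagram \<tau>"
  shows "(\<Sum>j \<in> {1..<reading (diagram \<tau>) x}. act (tr (reading (diagram \<tau>) x) j) (row_vector N \<tau>)) =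
    scale (of_int (content x)) (row_vector N \<tau>)"
proof -
  let ?E = "specht_poly \<tau> ` {T. is_tableau N \<tau> T}"
  interpret line_symmetric "diagram \<tau>" ?E 1 "row_vector N \<tau>"
  proof
    show "act w (row_vector N \<tau>) \<in> mpoly.span ?E" if "w permutes {1..card (diagram \<tau>)}" for w
      using act_specht_module [OF row_vector_in [OF part]] that
      by (simp add: card_diagram [OF part] specht_module_def)
    show "\<exists>T. bij_betw T (diagram \<tau>) {1..card (diagram \<tau>)} \<and> (\<forall>x \<in> diagram \<tau>. \<forall>y \<in> diagram \<tau>.
        x \<noteq> y \<longrightarrow> snd x = snd y \<longrightarrow> act (tr (T x) (T y)) e = scale (- 1) e)" if e: "e \<in> ?E" for e
    proof -
      obtain T where T: "bij_betw T (diagram \<tau>) {1..N}" "e = specht_poly \<tau> T"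
        using e by (auto simp: is_tableau_def)
      with act_specht_poly_column [OF young_diagram [OF part] bij_betw_imp_inj_on [OF T(1)]]
      show ?thesis
        by (intro exI [of _ T]) (simp add: card_diagram [OF part])
    qed
  qed (use part in \<open>auto simp: young_diagram row_vector_row\<close>)
  show ?thesis
    using murphy_eigenvector [OF x] by simp
qed

text \<open>
  With rows and columns exchanged, the translates of the row vector take over the role of the
  Specht polynomials; by irreducibility they span the module.
\<close>

lemma column_vector_murphy:
  assumes part: "is_partition \<tau> N" and x: "x \<in> diagram \<tau>"
    and span: "specht_module N \<tau> = mpoly.span {act w (row_vector N \<tau>) | w. w permutes {1..N}}"
    and T: "T = reading (prod.swap ` diagram \<tau>) \<circ> prod.swap"
  shows "(\<Sum>j \<in> {1..<T x}. act (tr (T x) j) (column_vector \<tau>)) =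
    scale (of_int (content x)) (column_vector \<tau>)"
proof -
  let ?D = "prod.swap ` diagram \<tau>" and ?E = "{act w (row_vector N \<tau>) | w. w permutes {1..N}}"
  have card: "card ?D = N"
    using card_diagram [OF part] by (simp add: card_image)
  note tab = is_tableau_reading_swap [OF part, folded T]
  interpret line_symmetric ?D ?E "-1" "column_vector \<tau>"
  proof
    show "young ?D"
      by (rule young_swap [OF young_diagram [OF part]])
    show "act w (column_vector \<tau>) \<in> mpoly.span ?E" if "w permutes {1..card ?D}" for w
      using act_specht_module [OF column_vector_in [OF part]] that by (simp add: card span)
    show "act (tr (reading ?D x) (reading ?D y)) (column_vector \<tau>) = scale (- 1) (column_vector \<tau>)"
      if xy: "x \<in> ?D" "y \<in> ?D" "x \<noteq> y" "fst x = fst y" for x y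
    proof -
      obtain x' y' where xy': "x' \<in> diagram \<tau>" "y' \<in> diagram \<tau>" "x = prod.swap x'" "y = prod.swap y'"
        using xy by blast
      have "act (tr (T x') (T y')) (specht_poly \<tau> T) = - specht_poly \<tau> T"
        using tab xy xy'
        by (intro act_specht_poly_column [OF young_diagram [OF part]]) (auto simp: is_tableau_def bij_betw_def)
      then show ?thesis
        using xy' by (simp add: column_vector_def T)
    qed
    show "\<exists>T. bij_betw T ?D {1..card ?D} \<and> (\<forall>x \<in> ?D. \<forall>y \<in> ?D.
        x \<noteq> y \<longrightarrow> snd x = snd y \<longrightarrow> act (tr (T x) (T y)) e = scale (- (- 1)) e)" if e: "e \<in> ?E" for e
    proof -
      obtain w where w: "w permutes {1..N}" "e = act w (row_vector N \<tau>)"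
        using e by blast
      let ?T = "w \<circ> reading (diagram \<tau>) \<circ> prod.swap"
      have "bij_betw prod.swap ?D (diagram \<tau>)"
        by (rule bij_betwI [of _ _ _ prod.swap]) auto
      moreover have "bij_betw (w \<circ> reading (diagram \<tau>)) (diagram \<tau>) {1..N}"
        using is_tableau_comp [OF is_tableau_reading [OF part] w(1)] by (simp add: is_tableau_def)
      ultimately have "bij_betw ?T ?D {1..card ?D}"
        unfolding card by (rule bij_betw_trans)
      moreover have "act (tr (?T x) (?T y)) e = e" if "x \<in> ?D" "y \<in> ?D" "snd x = snd y" for x y
      proof -
        have "prod.swap x \<in> diagram \<tau>" "prod.swap y \<in> diagram \<tau>"
          using that by auto
        then show ?thesis
          using that row_vector_row [OF part, of "prod.swap x" "prod.swap y"]
          by (simp add: w act_conj_tr [OF permutes_bij [OF w(1)], symmetric])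
      qed
      ultimately show ?thesis
        by (intro exI [of _ ?T]) simp
    qed
  qed simp
  \<comment> \<open>Transposing the diagram negates contents, which cancels \<epsilon> = -1; so both
    vectors have the content of a cell as eigenvalue at its label.\<close>
  have "prod.swap x \<in> ?D"
    using x by simp
  from murphy_eigenvector [OF this] show ?thesis
    by (simp add: T content_def)
qed

section \<open>Equivariant maps into singular polynomials\<close>

lemma var_nonzero: "var i \<noteq> 0"
  by (metis var_def lookup_single_eq lookup_zero zero_neq_one)

lemma divided_difference_linear:
  assumes "i \<noteq> j"
  shows "divided_difference i j (f + scale c g) = divided_difference i j f + scale c (divided_difference i j g)"
proof -
  have "divided_difference i j (f + scale c g) * (var i - var j) =
      (divided_difference i j f + scale c (divided_difference i j g)) * (var i - var j)"
    by (simp add: divided_difference_mult [OF assms] distrib_right scale_mult_left act_add act_scale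
        mpoly.scale_right_diff_distrib)
  then show ?thesis
    using assms by (simp add: var_eq_iff)
qed

lemma partial_deriv_linear:
  "partial_deriv i (f + scale c g) = partial_deriv i f + scale c (partial_deriv i g)"
proof -
  have "var i * partial_deriv i (f + scale c g) = var i * (partial_deriv i f + scale c (partial_deriv i g))"
    by (rule poly_mapping_eqI)
      (simp add: distrib_left scale_mult_right lookup_add lookup_var_mult_partial_deriv algebra_simps)
  then show ?thesis
    by (simp add: var_nonzero)
qed

lemma dunkl_linear: "dunkl N \<kappa> i (f + scale c g) = dunkl N \<kappa> i f + scale c (dunkl N \<kappa> i g)"
proof -
  have "(\<Sum>j \<in> {1..N} - {i}. divided_difference i j (f + scale c g)) =
      (\<Sum>j \<in> {1..N} - {i}. divided_difference i j f + scale c (divided_difference i j g))"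
    by (rule sum.cong) (auto simp: divided_difference_linear)
  then show ?thesis
    by (simp add: dunkl_def partial_deriv_linear sum.distrib mpoly.scale_sum_right
        mpoly.scale_right_distrib mult.commute add_ac)
qed

lemma dunkl_0: "dunkl N \<kappa> i 0 = 0"
  using dunkl_linear [of N \<kappa> i 0 1 0] by simp

text \<open>A secondary measure inside one orbit, where the sum of squares is constant. It grows
  when a larger exponent moves to a larger index, so maximizing it yields the sortedness required by
  \<open>extremal_eigenvalue\<close>.\<close>

definition weight :: "nat \<Rightarrow> monom \<Rightarrow> nat" where
  "weight N \<alpha> = (\<Sum>i = 1..N. i * lookup \<alpha> i)"

lemma weight_less_swap:
  assumes "a \<in> {1..N}" "b \<in> {1..N}" "a < b" "lookup \<alpha> b < lookup \<alpha> a"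
  shows "weight N \<alpha> < weight N (Poly_Mapping.map_key (tr a b) \<alpha>)"
proof -
  let ?\<beta> = "Poly_Mapping.map_key (tr a b) \<alpha>"
  have split: "weight N \<gamma> = a * lookup \<gamma> a + b * lookup \<gamma> b + (\<Sum>i \<in> {1..N} - {a} - {b}. i * lookup \<gamma> i)" for \<gamma>
    unfolding weight_def using assms(1-3)
      sum.remove [of "{1..N}" a "\<lambda>i. i * lookup \<gamma> i"]
      sum.remove [of "{1..N} - {a}" b "\<lambda>i. i * lookup \<gamma> i"] by simp
  have rest: "(\<Sum>i \<in> {1..N} - {a} - {b}. i * lookup ?\<beta> i) = (\<Sum>i \<in> {1..N} - {a} - {b}. i * lookup \<alpha> i)"
    by (rule sum.cong) (auto simp: lookup_map_key Transposition.transpose_def)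
  obtain k l where "b = a + Suc k" "lookup \<alpha> a = lookup \<alpha> b + Suc l"
    using assms(3,4) by (metis less_imp_Suc_add add_Suc_right)
  then show ?thesis
    unfolding split [of \<alpha>] split [of ?\<beta>] rest by (simp add: lookup_map_key algebra_simps)
qed

section \<open>Permutation orbits of exponents\<close>

definition orbit :: "nat \<Rightarrow> monom \<Rightarrow> monom set" where
  "orbit N \<alpha> = (\<lambda>w. Poly_Mapping.map_key w \<alpha>) ` {w. w permutes {1..N}}"

lemma finite_orbit: "finite (orbit N \<alpha>)"
  by (simp add: orbit_def finite_permutations)

lemma orbit_self: "\<alpha> \<in> orbit N \<alpha>"
  unfolding orbit_def
  by (rule image_eqI [of _ _ id]) (auto simp: permutes_id lookup_map_key intro!: poly_mapping_eqI)

lemma map_key_in_orbit: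
  assumes "\<beta> \<in> orbit N \<alpha>" "v permutes {1..N}"
  shows "Poly_Mapping.map_key v \<beta> \<in> orbit N \<alpha>"
proof -
  obtain w where w: "w permutes {1..N}" "\<beta> = Poly_Mapping.map_key w \<alpha>"
    using assms(1) by (auto simp: orbit_def)
  then have "Poly_Mapping.map_key v \<beta> = Poly_Mapping.map_key (w \<circ> v) \<alpha>"
    using assms(2) by (simp add: map_key_compose permutes_inj)
  then show ?thesis
    unfolding orbit_def using permutes_compose [OF assms(2) w(1)] by blast
qed

lemma orbit_invariants:
  assumes "\<beta> \<in> orbit N \<alpha>"
  shows "sum_squares N \<beta> = sum_squares N \<alpha>" and "count_below N \<beta> = count_below N \<alpha>"
    and "i \<notin> {1..N} \<Longrightarrow> lookup \<beta> i = lookup \<alpha> i"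
proof -
  obtain w where w: "w permutes {1..N}" "\<beta> = Poly_Mapping.map_key w \<alpha>"
    using assms by (auto simp: orbit_def)
  have \<beta>: "lookup \<beta> i = lookup \<alpha> (w i)" for i
    using w by (simp add: lookup_map_key permutes_inj)
  show "sum_squares N \<beta> = sum_squares N \<alpha>"
    unfolding sum_squares_def \<beta>
    using sum.permute [OF w(1), of "\<lambda>i. (lookup \<alpha> i)\<^sup>2"] by (simp add: comp_def)
  show "count_below N \<beta> = count_below N \<alpha>"
  proof
    fix v
    have "bij_betw w {j \<in> {1..N}. lookup \<beta> j < v} {j \<in> {1..N}. lookup \<alpha> j < v}"
      by (rule bij_betwI [of _ _ _ "inv w"])
        (use w(1) permutes_in_image [OF w(1)] permutes_in_image [OF permutes_inv [OF w(1)]]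
          in \<open>auto simp: \<beta> permutes_inverses\<close>)
    then show "count_below N \<beta> v = count_below N \<alpha> v"
      unfolding count_below_def by (rule bij_betw_same_card)
  qed
  show "lookup \<beta> i = lookup \<alpha> i" if "i \<notin> {1..N}"
    using permutes_not_in [OF w(1) that] by (simp add: \<beta>)
qed

text \<open>The maps under study send the Specht module into the common kernel of the Dunkl
  operators. Boundedness stands in for homogeneity, so that combinations of maps into different
  degrees qualify again. Irreducibility of the source is an assumption, discharged later from the
  given submodule.\<close>

locale singular_map =
  fixes N m n :: nat and \<tau> :: "nat list" and \<eta> :: "mpoly \<Rightarrow> mpoly" and \<kappa> :: rat
  assumes part: "is_partition \<tau> N"
    and m: "m > 0" and n: "n > 0" and \<kappa>: "\<kappa> = - (of_nat m / of_nat n)"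
    and irreducible: "\<And>L. L \<subseteq> specht_module N \<tau> \<Longrightarrow> mpoly.subspace L \<Longrightarrow>
      (\<And>w f. w permutes {1..N} \<Longrightarrow> f \<in> L \<Longrightarrow> act w f \<in> L) \<Longrightarrow> L = {0} \<or> L = specht_module N \<tau>"
    and add: "\<And>f g. f \<in> specht_module N \<tau> \<Longrightarrow> g \<in> specht_module N \<tau> \<Longrightarrow> \<eta> (f + g) = \<eta> f + \<eta> g"
    and scale: "\<And>c f. f \<in> specht_module N \<tau> \<Longrightarrow> \<eta> (scale c f) = scale c (\<eta> f)"
    and act: "\<And>w f. w permutes {1..N} \<Longrightarrow> f \<in> specht_module N \<tau> \<Longrightarrow> \<eta> (act w f) = act w (\<eta> f)"
    and dunkl: "\<And>i f. i \<in> {1..N} \<Longrightarrow> f \<in> specht_module N \<tau> \<Longrightarrow> dunkl N \<kappa> i (\<eta> f) = 0"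
    and polys: "\<And>f. f \<in> specht_module N \<tau> \<Longrightarrow> \<eta> f \<in> polys N"
    and bounded: "\<exists>B. \<forall>f \<in> specht_module N \<tau>. \<forall>\<alpha> \<in> keys (\<eta> f). sum_squares N \<alpha> \<le> B"
    and nonzero: "\<exists>f \<in> specht_module N \<tau>. \<eta> f \<noteq> 0"
begin

abbreviation "S \<equiv> specht_module N \<tau>"
abbreviation "D \<equiv> diagram \<tau>"

lemma subspace_S: "mpoly.subspace S"
  by (simp add: specht_module_def)

lemma zero: "\<eta> 0 = 0"
  using scale [of 0 0] mpoly.subspace_0 [OF subspace_S] by simp

lemma sum_act:
  assumes "f \<in> S" "i \<in> {1..N}" "A \<subseteq> {1..N}"
  shows "\<eta> (\<Sum>j \<in> A. act (tr i j) f) = (\<Sum>j \<in> A. act (tr i j) (\<eta> f))"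
proof -
  have "finite A"
    using assms(3) by (rule finite_subset) simp
  then show ?thesis
    using assms(3)
  proof (induction A rule: finite_induct)
    case (insert j A)
    have "act (tr i k) f \<in> S" "\<eta> (act (tr i k) f) = act (tr i k) (\<eta> f)" if "k \<in> insert j A" for k
      using that insert.prems assms(1,2) by (auto intro!: act_specht_module act permutes_swap_id)
    with insert show ?case
      by (simp add: add mpoly.subspace_sum [OF subspace_S])
  qed (simp add: zero)
qed

text \<open>The maximum is taken over the whole image of \<eta>, so that a single orbit serves all
  vectors.\<close>

definition top_exponent :: monom where
  "top_exponent = (SOME \<alpha>. (\<exists>f \<in> S. \<alpha> \<in> keys (\<eta> f)) \<and>
     (\<forall>f \<in> S. \<forall>\<beta> \<in> keys (\<eta> f). sum_squares N \<beta> \<le> sum_squares N \<alpha>))"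

lemma top_exponent: "\<exists>f \<in> S. top_exponent \<in> keys (\<eta> f)" "\<And>f \<beta>. f \<in> S \<Longrightarrow> \<beta> \<in> keys (\<eta> f) \<Longrightarrow> sum_squares N \<beta> \<le> sum_squares N top_exponent"
proof -
  let ?P = "\<lambda>\<alpha>. \<exists>f \<in> S. \<alpha> \<in> keys (\<eta> f)"
  obtain B where B: "\<And>f \<alpha>. f \<in> S \<Longrightarrow> \<alpha> \<in> keys (\<eta> f) \<Longrightarrow> sum_squares N \<alpha> \<le> B"
    using bounded by blast
  obtain f where f: "f \<in> S" "\<eta> f \<noteq> 0"
    using nonzero by blast
  then obtain \<alpha> where "\<alpha> \<in> keys (\<eta> f)"
    by (metis poly_mapping_eqI in_keys_iff lookup_zero)
  with f have "?P \<alpha>"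
    by blast
  then have "\<exists>\<alpha>. ?P \<alpha> \<and> (\<forall>\<beta>. ?P \<beta> \<longrightarrow> sum_squares N \<beta> \<le> sum_squares N \<alpha>)"
    by (rule ex_has_greatest_nat [of _ _ _ "Suc B"]) (use B in \<open>auto simp: less_Suc_eq_le\<close>)
  then have "\<exists>\<alpha>. ?P \<alpha> \<and> (\<forall>f \<in> S. \<forall>\<beta> \<in> keys (\<eta> f). sum_squares N \<beta> \<le> sum_squares N \<alpha>)"
    by blast
  then have "?P top_exponent \<and> (\<forall>f \<in> S. \<forall>\<beta> \<in> keys (\<eta> f). sum_squares N \<beta> \<le> sum_squares N top_exponent)"
    unfolding top_exponent_def by (rule someI_ex)
  then show "?P top_exponent" "\<And>f \<beta>. f \<in> S \<Longrightarrow> \<beta> \<in> keys (\<eta> f) \<Longrightarrow> sum_squares N \<beta> \<le> sum_squares N top_exponent"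
    by blast+
qed

text \<open>Projecting onto the span of one orbit of extremal monomials is equivariant, hence injective.\<close>

lemma orbit_coefficient:
  assumes g: "g \<in> S" "g \<noteq> 0"
  obtains \<alpha> where "\<alpha> \<in> orbit N top_exponent" "lookup (\<eta> g) \<alpha> \<noteq> 0"
proof -
  define L where "L = {f \<in> S. \<forall>\<alpha> \<in> orbit N top_exponent. lookup (\<eta> f) \<alpha> = 0}"
  have "L = {0} \<or> L = S"
  proof (rule irreducible)
    show "mpoly.subspace L"
      using subspace_S by (auto simp: mpoly.subspace_def L_def zero add scale lookup_add)
    show "act w f \<in> L" if "w permutes {1..N}" "f \<in> L" for w f
      using that map_key_in_orbit
      by (auto simp: L_def act_specht_module act lookup_act permutes_bij)
  qed (auto simp: L_def)
  moreover obtain f where "f \<in> S" "top_exponent \<in> keys (\<eta> f)"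
    using top_exponent(1) by blast
  then have "f \<notin> L"
    using orbit_self by (auto simp: L_def in_keys_iff)
  ultimately have "g \<notin> L"
    using \<open>f \<in> S\<close> g by auto
  then show ?thesis
    using that g by (auto simp: L_def)
qed

text \<open>Among the exponents of the top orbit occurring in \<open>\<eta> g\<close>, one of
  maximal \<open>weight\<close> is sorted in the sense of \<open>extremal_eigenvalue\<close>;
  multiplying the resulting relation by \<open>n\<close> makes it integral.\<close>

lemma extremal_exponent:
  assumes g: "g \<in> S" "g \<noteq> 0" and T: "bij_betw T D {1..N}"
    and murphy: "\<And>x. x \<in> D \<Longrightarrow> (\<Sum>j \<in> {1..<T x}. act (tr (T x) j) g) = scale (of_int (content x)) g"
  obtains \<alpha> where "\<alpha> \<in> orbit N top_exponent" "lookup (\<eta> g) \<alpha> \<noteq> 0"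
    and "\<And>x. x \<in> D \<Longrightarrow> int n * int (lookup \<alpha> (T x)) = int m * (int (rank N \<alpha> (T x)) - content x)"
    and "\<And>a b. a \<in> {1..N} \<Longrightarrow> b \<in> {1..N} \<Longrightarrow> a < b \<Longrightarrow> lookup \<alpha> b < lookup \<alpha> a \<Longrightarrow>
      lookup (\<eta> g) (Poly_Mapping.map_key (tr a b) \<alpha>) = 0"
proof -
  let ?A = "{\<alpha> \<in> orbit N top_exponent. lookup (\<eta> g) \<alpha> \<noteq> 0}"
  have fin: "finite ?A"
    using finite_orbit by simp
  have "?A \<noteq> {}"
    using orbit_coefficient [OF g] by blast
  then have "Max (weight N ` ?A) \<in> weight N ` ?A"
    using fin by (intro Max_in) auto
  then obtain \<alpha> where \<alpha>: "\<alpha> \<in> ?A" "weight N \<alpha> = Max (weight N ` ?A)"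
    by auto
  have max: "weight N \<beta> \<le> weight N \<alpha>" if "\<beta> \<in> ?A" for \<beta>
    using that fin by (simp add: \<alpha>(2))
  have sorted: "lookup (\<eta> g) (Poly_Mapping.map_key (tr a b) \<alpha>) = 0"
    if "a \<in> {1..N}" "b \<in> {1..N}" "a < b" "lookup \<alpha> b < lookup \<alpha> a" for a b
  proof (rule ccontr)
    assume "lookup (\<eta> g) (Poly_Mapping.map_key (tr a b) \<alpha>) \<noteq> 0"
    then have "Poly_Mapping.map_key (tr a b) \<alpha> \<in> ?A"
      using \<alpha>(1) map_key_in_orbit [OF _ permutes_swap_id [OF that(1,2)]] by simp
    from max [OF this] weight_less_swap [OF that] show False
      by simp
  qed
  have "int n * int (lookup \<alpha> (T x)) = int m * (int (rank N \<alpha> (T x)) - content x)" if x: "x \<in> D" for x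
  proof -
    have Tx: "T x \<in> {1..N}"
      using bij_betwE [OF T] x by blast
    have "(\<Sum>j \<in> {1..<T x}. act (tr (T x) j) (\<eta> g)) = scale (of_int (content x)) (\<eta> g)"
      using arg_cong [OF murphy [OF x], of \<eta>] g(1) Tx by (subst (asm) sum_act) (auto simp: scale)
    moreover have "lookup (\<eta> g) \<beta> = 0" if "sum_squares N \<alpha> < sum_squares N \<beta>" for \<beta>
      using top_exponent(2) [OF g(1), of \<beta>] that orbit_invariants(1) [of \<alpha> N top_exponent] \<alpha>(1)
      by (auto simp: in_keys_iff)
    ultimately have "of_nat (lookup \<alpha> (T x)) + \<kappa> * of_nat (rank N \<alpha> (T x)) = \<kappa> * of_int (content x)"
      using \<alpha>(1) by (intro extremal_eigenvalue [OF dunkl [OF Tx g(1)] Tx] sorted) auto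
    then have a: "of_nat (lookup \<alpha> (T x)) = \<kappa> * (of_int (content x) - of_nat (rank N \<alpha> (T x)))"
      by (simp add: algebra_simps)
    have "of_nat n * \<kappa> = - of_nat m"
      using n by (simp add: \<kappa>)
    then have "(of_nat n * of_nat (lookup \<alpha> (T x)) :: rat) =
        - of_nat m * (of_int (content x) - of_nat (rank N \<alpha> (T x)))"
      unfolding a by (simp only: mult.assoc [symmetric])
    then have "(of_int (int n * int (lookup \<alpha> (T x))) :: rat) =
        of_int (int m * (int (rank N \<alpha> (T x)) - content x))"
      by (simp add: algebra_simps)
    then show ?thesis
      by (simp only: of_int_eq_iff)
  qed
  with sorted \<alpha>(1) show ?thesis
    by (intro that [of \<alpha>]) auto
qed

lemma row_vector_span: "S = mpoly.span {act w (row_vector N \<tau>) | w. w permutes {1..N}}"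
proof -
  let ?E = "{act w (row_vector N \<tau>) | w. w permutes {1..N}}"
  have "mpoly.span ?E = {0} \<or> mpoly.span ?E = S"
  proof (rule irreducible)
    show "mpoly.span ?E \<subseteq> S"
      using act_specht_module [OF row_vector_in [OF part]]
      by (intro mpoly.span_minimal subspace_S) auto
    show "act w f \<in> mpoly.span ?E" if w: "w permutes {1..N}" and f: "f \<in> mpoly.span ?E" for w f
      using f
    proof (induction rule: mpoly.span_induct_alt)
      case base
      show ?case
        by (simp add: mpoly.span_zero)
    next
      case (step c e g)
      then obtain v where v: "v permutes {1..N}" "e = act v (row_vector N \<tau>)"
        by blast
      then have "act w e \<in> ?E"
        using permutes_compose [OF v(1) w] by (auto simp: act_act)
      then show ?case
        unfolding act_add act_scale using step.IH
        by (rule mpoly.span_add [OF mpoly.span_scale [OF mpoly.span_base]])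
    qed
  qed simp
  moreover have "row_vector N \<tau> \<in> mpoly.span ?E"
  proof (rule mpoly.span_base, intro CollectI exI conjI)
    show "row_vector N \<tau> = act id (row_vector N \<tau>)"
      by simp
  qed (rule permutes_id)
  ultimately show ?thesis
    using row_vector_nonzero [OF part] by auto
qed

text \<open>With the rank replaced by the position in the diagram, the relation no longer mentions
  \<eta>, and this makes the exponent common to all such maps. The replacement comes from
  \<open>enumerations_eq_position\<close>, applied to the ranks in an exponent \<alpha> of the row
  vector and an exponent \<beta> of the column vector.\<close>

lemma row_vector_coefficient:
  obtains \<alpha> where "keys \<alpha> \<subseteq> {1..N}" "lookup (\<eta> (row_vector N \<tau>)) \<alpha> \<noteq> 0"
    and "\<And>x. x \<in> D \<Longrightarrow>
      int n * int (lookup \<alpha> (reading D x)) = int m * (int (position D x) - content x)"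
proof -
  let ?T = "reading D" and ?r = "row_vector N \<tau>" and ?c = "column_vector \<tau>"
  define T' where "T' = reading (prod.swap ` D) \<circ> prod.swap"
  note young = young_diagram [OF part] and card = card_diagram [OF part]
  note fin = young_finite [OF young]
  have T: "bij_betw ?T D {1..N}"
    using is_tableau_reading [OF part] by (simp add: is_tableau_def)
  have T': "bij_betw T' D {1..N}"
    using is_tableau_reading_swap [OF part] by (simp add: is_tableau_def T'_def)
  have c0: "?c \<noteq> 0"
    using T' specht_poly_nonzero [OF fin] by (simp add: column_vector_def bij_betw_def flip: T'_def)
  obtain \<alpha> where \<alpha>: "\<alpha> \<in> orbit N top_exponent" "lookup (\<eta> ?r) \<alpha> \<noteq> 0"
    and eq\<alpha>: "\<And>x. x \<in> D \<Longrightarrow> int n * int (lookup \<alpha> (?T x)) = int m * (int (rank N \<alpha> (?T x)) - content x)"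
    and sort\<alpha>: "\<And>a b. a \<in> {1..N} \<Longrightarrow> b \<in> {1..N} \<Longrightarrow> a < b \<Longrightarrow> lookup \<alpha> b < lookup \<alpha> a \<Longrightarrow>
      lookup (\<eta> ?r) (Poly_Mapping.map_key (tr a b) \<alpha>) = 0"
    by (rule extremal_exponent [OF row_vector_in [OF part] row_vector_nonzero [OF part] T
          row_vector_murphy [OF part]], assumption) (rule that; blast)
  obtain \<beta> where \<beta>: "\<beta> \<in> orbit N top_exponent" "lookup (\<eta> ?c) \<beta> \<noteq> 0"
    and eq\<beta>: "\<And>x. x \<in> D \<Longrightarrow> int n * int (lookup \<beta> (T' x)) = int m * (int (rank N \<beta> (T' x)) - content x)"
    and sort\<beta>: "\<And>a b. a \<in> {1..N} \<Longrightarrow> b \<in> {1..N} \<Longrightarrow> a < b \<Longrightarrow> lookup \<beta> b < lookup \<beta> a \<Longrightarrow>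
      lookup (\<eta> ?c) (Poly_Mapping.map_key (tr a b) \<beta>) = 0"
    by (rule extremal_exponent [OF column_vector_in [OF part] c0 T'
          column_vector_murphy [OF part _ row_vector_span T'_def]], assumption) (rule that; blast)
  have count: "count_below N \<alpha> = count_below N \<beta>"
    using orbit_invariants(2) [OF \<alpha>(1)] orbit_invariants(2) [OF \<beta>(1)] by simp
  have bij: "bij_betw (rank N \<alpha> \<circ> ?T) D {..<card D}" "bij_betw (rank N \<beta> \<circ> T') D {..<card D}"
    unfolding card by (rule bij_betw_trans [OF T bij_betw_rank], rule bij_betw_trans [OF T' bij_betw_rank])
  have inT: "?T x \<in> {1..N}" "T' x \<in> {1..N}" if "x \<in> D" for x
    using bij_betwE [OF T] bij_betwE [OF T'] that by blast+
  have "(rank N \<alpha> \<circ> ?T) x = position D x" if "x \<in> D" for x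
  proof (rule conjunct1 [OF enumerations_eq_position [OF young bij]])
    \<comment> \<open>Both exponents lie in one orbit, so equal ranks force equal exponents, and the
      two relations then leave equal contents.\<close>
    fix x y assume xy: "x \<in> D" "y \<in> D" and eq: "(rank N \<alpha> \<circ> ?T) x = (rank N \<beta> \<circ> T') y"
    then have "lookup \<alpha> (?T x) = lookup \<beta> (T' y)"
      using rank_less_rank [OF inT(1) [OF xy(1)], of \<alpha> \<beta> "T' y"]
        rank_less_rank [OF inT(2) [OF xy(2)], of \<beta> \<alpha> "?T x"] count
      by (metis comp_apply less_irrefl linorder_neqE_nat)
    then have "int n * int (lookup \<alpha> (?T x)) = int n * int (lookup \<beta> (T' y))"
      by simp
    then have "int m * (int (rank N \<alpha> (?T x)) - content x) = int m * (int (rank N \<beta> (T' y)) - content y)"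
      by (simp only: eq\<alpha> [OF xy(1)] eq\<beta> [OF xy(2)])
    then show "content x = content y"
      using m eq by simp
  next
    fix r c assume D: "(r, c) \<in> D" "(r, Suc c) \<in> D"
    let ?i = "?T (r, c)" and ?j = "?T (r, Suc c)"
    have less: "?i < ?j"
      using reading_less_iff [OF fin D] by simp
    \<comment> \<open>Invariance makes the swapped coefficient nonzero, so sortedness excludes a
      descent; a tie is decided by the index order of the row reading.\<close>
    have "act (tr ?i ?j) (\<eta> ?r) = \<eta> ?r"
      using act [OF permutes_swap_id [OF inT(1) [OF D(1)] inT(1) [OF D(2)]] row_vector_in [OF part]]
        row_vector_row [OF part D] by simp
    then have "lookup (\<eta> ?r) (Poly_Mapping.map_key (tr ?i ?j) \<alpha>) \<noteq> 0"
      using \<alpha>(2) lookup_act [of "tr ?i ?j" "\<eta> ?r" \<alpha>] by simp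
    then have "lookup \<alpha> ?i \<le> lookup \<alpha> ?j"
      using sort\<alpha> [OF inT(1) [OF D(1)] inT(1) [OF D(2)] less] by (meson not_le)
    then show "(rank N \<alpha> \<circ> ?T) (r, c) < (rank N \<alpha> \<circ> ?T) (r, Suc c)"
      using rank_less_rank [OF inT(1) [OF D(1)], of \<alpha> \<alpha> ?j] rank_less_tie [OF inT(1) [OF D(1)] less, of \<alpha>]
      by (auto simp: le_less)
  next
    fix r c assume D: "(r, c) \<in> D" "(Suc r, c) \<in> D"
    let ?i = "T' (r, c)" and ?j = "T' (Suc r, c)"
    have "(c, r) < (c, Suc r)"
      by simp
    then have less: "?i < ?j"
      using reading_less_iff [of "prod.swap ` D" "(c, r)" "(c, Suc r)"] D fin
      by (force simp: T'_def)
    \<comment> \<open>Antisymmetry excludes a descent as before, and also a tie, where the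
      coefficient would equal its own negative.\<close>
    have "act (tr ?i ?j) ?c = - ?c"
      using act_specht_poly_column [OF young bij_betw_imp_inj_on [OF T'] D]
      by (simp add: column_vector_def flip: T'_def)
    then have "act (tr ?i ?j) (\<eta> ?c) = \<eta> (scale (-1) ?c)"
      using act [OF permutes_swap_id [OF inT(2) [OF D(1)] inT(2) [OF D(2)]] column_vector_in [OF part]]
      by simp
    then have anti: "lookup (\<eta> ?c) (Poly_Mapping.map_key (tr ?i ?j) \<beta>) = - lookup (\<eta> ?c) \<beta>"
      using lookup_act [of "tr ?i ?j" "\<eta> ?c" \<beta>] scale [OF column_vector_in [OF part], of "-1"] by simp
    have "lookup \<beta> ?i \<noteq> lookup \<beta> ?j"
    proof
      assume eq: "lookup \<beta> ?i = lookup \<beta> ?j"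
      have "Poly_Mapping.map_key (tr ?i ?j) \<beta> = \<beta>"
        by (rule poly_mapping_eqI) (use eq in \<open>auto simp: lookup_map_key Transposition.transpose_def\<close>)
      with anti \<beta>(2) show False
        by simp
    qed
    moreover have "\<not> lookup \<beta> ?j < lookup \<beta> ?i"
      using sort\<beta> [OF inT(2) [OF D(1)] inT(2) [OF D(2)] less] anti \<beta>(2) by auto
    ultimately show "(rank N \<beta> \<circ> T') (r, c) < (rank N \<beta> \<circ> T') (Suc r, c)"
      using rank_less_rank [OF inT(2) [OF D(1)], of \<beta> \<beta> ?j] by simp
  next
    fix x y assume xy: "x \<in> D" "y \<in> D" and Suc: "(rank N \<beta> \<circ> T') y = Suc ((rank N \<beta> \<circ> T') x)"
    \<comment> \<open>Here the sign of \<kappa> enters: exponents weakly increase with rank, and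
      since m > 0, so does rank minus content.\<close>
    then have "lookup \<beta> (T' x) \<le> lookup \<beta> (T' y)"
      using rank_less_rank [OF inT(2) [OF xy(2)], of \<beta> \<beta> "T' x"] by (cases "lookup \<beta> (T' y) < lookup \<beta> (T' x)") auto
    then have "int n * int (lookup \<beta> (T' x)) \<le> int n * int (lookup \<beta> (T' y))"
      by (intro mult_left_mono) auto
    then have "int m * (int (rank N \<beta> (T' x)) - content x) \<le> int m * (int (rank N \<beta> (T' y)) - content y)"
      using eq\<beta> [OF xy(1)] eq\<beta> [OF xy(2)] by simp
    then show "content y \<le> content x + 1"
      using m Suc by simp
  qed fact
  then have "int n * int (lookup \<alpha> (?T x)) = int m * (int (position D x) - content x)" if "x \<in> D" for x
    using eq\<alpha> [OF that] that by simp
  moreover obtain f where "f \<in> S" "top_exponent \<in> keys (\<eta> f)"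
    using top_exponent(1) by blast
  then have "keys top_exponent \<subseteq> {1..N}"
    using polys by (auto simp: polys_def)
  then have "keys \<alpha> \<subseteq> {1..N}"
    using orbit_invariants(3) [OF \<alpha>(1)] by (metis in_keys_iff subset_iff)
  ultimately show ?thesis
    using that \<alpha>(2) by blast
qed

end

section \<open>Uniqueness\<close>

lemma sum_squares_homogeneous:
  assumes "f \<in> homogeneous N d" "\<alpha> \<in> keys f"
  shows "sum_squares N \<alpha> \<le> d * d"
proof -
  have d: "(\<Sum>i = 1..N. lookup \<alpha> i) = d"
    using assms by (simp add: homogeneous_def)
  have "sum_squares N \<alpha> \<le> (\<Sum>i = 1..N. d * lookup \<alpha> i)"
    unfolding sum_squares_def power2_eq_square
    by (intro sum_mono mult_right_mono)
      (auto simp flip: d intro!: member_le_sum)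
  then show ?thesis
    unfolding sum_distrib_left [symmetric] d .
qed

text \<open>The map is the inverse of the isomorphism onto the Specht module. A submodule of the
  Specht module is carried by it into \<open>M\<close>, where irreducibility is known.\<close>

lemma singular_map_of_submodule:
  assumes part: "is_partition \<tau> N"
    and mn: "m > 0" "n > 0" "\<kappa> = - (of_nat m / of_nat n)"
    and irr: "irreducible_submodule N M" and hom: "M \<subseteq> homogeneous N d"
    and sing: "\<forall>p \<in> M - {0}. singular N \<kappa> p" and iso: "has_isotype N \<tau> M"
  obtains \<eta> where "singular_map N m n \<tau> \<eta> \<kappa>" "\<eta> ` specht_module N \<tau> = M"
proof -
  let ?S = "specht_module N \<tau>"
  obtain \<phi> where bij: "bij_betw \<phi> M ?S"
    and \<phi>: "\<And>f g. f \<in> M \<Longrightarrow> g \<in> M \<Longrightarrow> \<phi> (f + g) = \<phi> f + \<phi> g"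
      "\<And>c f. f \<in> M \<Longrightarrow> \<phi> (scale c f) = scale c (\<phi> f)"
      "\<And>w f. w permutes {1..N} \<Longrightarrow> f \<in> M \<Longrightarrow> \<phi> (act w f) = act w (\<phi> f)"
    using iso unfolding has_isotype_def module_isomorphic_def by blast
  have subM: "mpoly.subspace M" "M \<subseteq> polys N" "\<And>w f. w permutes {1..N} \<Longrightarrow> f \<in> M \<Longrightarrow> act w f \<in> M"
    and irrM: "\<And>L. sym_submodule N L \<Longrightarrow> L \<subseteq> M \<Longrightarrow> L = {0} \<or> L = M" and "M \<noteq> {0}"
    using irr unfolding irreducible_submodule_def sym_submodule_def by blast+
  define \<eta> where "\<eta> = inv_into M \<phi>"
  have \<eta>bij: "bij_betw \<eta> ?S M"
    unfolding \<eta>_def by (rule bij_betw_inv_into [OF bij])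
  have \<eta>M: "\<eta> f \<in> M" "\<phi> (\<eta> f) = f" if "f \<in> ?S" for f
    using that bij_betwE [OF \<eta>bij] bij_betw_inv_into_right [OF bij] by (auto simp: \<eta>_def)
  have \<eta>\<phi>: "\<eta> (\<phi> g) = g" if "g \<in> M" for g
    using that bij_betw_inv_into_left [OF bij] by (simp add: \<eta>_def)
  have add: "\<eta> (f + g) = \<eta> f + \<eta> g" if "f \<in> ?S" "g \<in> ?S" for f g
    using \<eta>\<phi> [OF mpoly.subspace_add [OF subM(1) \<eta>M(1) \<eta>M(1)]] that by (simp add: \<phi> \<eta>M)
  have scale: "\<eta> (scale c f) = scale c (\<eta> f)" if "f \<in> ?S" for c f
    using \<eta>\<phi> [OF mpoly.subspace_scale [OF subM(1) \<eta>M(1)]] that by (simp add: \<phi> \<eta>M)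
  have act: "\<eta> (act w f) = act w (\<eta> f)" if "w permutes {1..N}" "f \<in> ?S" for w f
    using \<eta>\<phi> [OF subM(3) [OF that(1) \<eta>M(1)]] that by (simp add: \<phi> \<eta>M)
  have "singular_map N m n \<tau> \<eta> \<kappa>"
  proof
    fix L assume L: "L \<subseteq> ?S" "mpoly.subspace L" "\<And>w f. w permutes {1..N} \<Longrightarrow> f \<in> L \<Longrightarrow> act w f \<in> L"
    have LM: "\<eta> ` L \<subseteq> M"
      using L(1) \<eta>M(1) by auto
    have inj: "inj_on \<eta> ?S"
      using \<eta>bij by (rule bij_betw_imp_inj_on)
    have zero: "0 \<in> L" "0 \<in> ?S"
      using mpoly.subspace_0 [OF L(2)] L(1) by auto
    have "\<eta> 0 = 0"
      using scale [OF zero(2), of 0] by simp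
    have add': "\<eta> f + \<eta> g = \<eta> (f + g)" "scale c (\<eta> f) = \<eta> (scale c f)" if "f \<in> L" "g \<in> L" for f g c
      using add [OF subsetD [OF L(1)] subsetD [OF L(1)]] scale [OF subsetD [OF L(1)]] that by simp_all
    have act': "act w (\<eta> f) = \<eta> (act w f)" if "w permutes {1..N}" "f \<in> L" for w f
      using act [of w f] that L(1) by auto
    have "mpoly.subspace (\<eta> ` L)"
      unfolding mpoly.subspace_def
    proof (intro conjI ballI allI)
      show "0 \<in> \<eta> ` L"
        using zero(1) \<open>\<eta> 0 = 0\<close> by force
    qed (use L(2) in \<open>auto simp: add' mpoly.subspace_add mpoly.subspace_scale\<close>)
    moreover have "act w f \<in> \<eta> ` L" if "w permutes {1..N}" "f \<in> \<eta> ` L" for w f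
      using that L(3) by (auto simp: act')
    ultimately have "\<eta> ` L = {0} \<or> \<eta> ` L = M"
      using LM subM(2) by (intro irrM) (auto simp: sym_submodule_def)
    moreover have "L = {0}" if "\<eta> ` L = {0}"
      using that inj_on_image_eq_iff [OF inj L(1), of "{0}"] zero \<open>\<eta> 0 = 0\<close> by simp
    moreover have "L = ?S" if "\<eta> ` L = M"
      using that inj_on_image_eq_iff [OF inj L(1), of ?S] \<eta>bij by (simp add: bij_betw_def)
    ultimately show "L = {0} \<or> L = ?S"
      by blast
  next
    fix i f assume "i \<in> {1..N}" "f \<in> ?S"
    then show "dunkl N \<kappa> i (\<eta> f) = 0"
      using sing \<eta>M(1) [of f] by (cases "\<eta> f = 0") (auto simp: dunkl_0 singular_def)
  next
    show "\<exists>B. \<forall>f \<in> ?S. \<forall>\<alpha> \<in> keys (\<eta> f). sum_squares N \<alpha> \<le> B"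
      using sum_squares_homogeneous hom \<eta>M(1) by (meson subsetD)
    have "0 \<in> M"
      using mpoly.subspace_0 [OF subM(1)] .
    then obtain g where "g \<in> M" "g \<noteq> 0"
      using \<open>M \<noteq> {0}\<close> by blast
    then show "\<exists>f \<in> ?S. \<eta> f \<noteq> 0"
      using \<eta>\<phi> bij_betwE [OF bij] by metis
  qed (use part mn add scale act subM(2) \<eta>M(1) in auto)
  with \<eta>bij show ?thesis
    using that by (simp add: bij_betw_def)
qed

text \<open>
  All these maps give the row vector a nonzero coefficient at the same exponent, so a suitable
  combination of two of them cannot be such a map again.
\<close>

lemma singular_map_unique:
  assumes 1: "singular_map N m n \<tau> \<eta>\<^sub>1 \<kappa>" and 2: "singular_map N m n \<tau> \<eta>\<^sub>2 \<kappa>"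
  obtains c where "\<And>f. f \<in> specht_module N \<tau> \<Longrightarrow> \<eta>\<^sub>2 f = scale c (\<eta>\<^sub>1 f)"
proof -
  let ?D = "diagram \<tau>" and ?r = "row_vector N \<tau>" and ?S = "specht_module N \<tau>"
  interpret s1: singular_map N m n \<tau> \<eta>\<^sub>1 \<kappa> by (rule 1)
  interpret s2: singular_map N m n \<tau> \<eta>\<^sub>2 \<kappa> by (rule 2)
  \<comment> \<open>Every index from 1 to \<open>N\<close> is the label of a cell, and n > 0, so the
    relations determine all exponents.\<close>
  have unique: "\<alpha> = \<beta>"
    if "keys \<alpha> \<subseteq> {1..N}" "keys \<beta> \<subseteq> {1..N}"
      "\<And>x. x \<in> ?D \<Longrightarrow> int n * int (lookup \<alpha> (reading ?D x)) = int m * (int (position ?D x) - content x)"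
      "\<And>x. x \<in> ?D \<Longrightarrow> int n * int (lookup \<beta> (reading ?D x)) = int m * (int (position ?D x) - content x)"
    for \<alpha> \<beta>
  proof (rule poly_mapping_eqI)
    fix i
    show "lookup \<alpha> i = lookup \<beta> i"
    proof (cases "i \<in> {1..N}")
      case True
      then obtain x where x: "x \<in> ?D" "i = reading ?D x"
        using is_tableau_reading [OF s1.part] unfolding is_tableau_def by (metis bij_betw_def imageE)
      then have "int n * int (lookup \<alpha> i) = int n * int (lookup \<beta> i)"
        using that(3,4) [OF x(1)] by simp
      then show ?thesis
        using s1.n by simp
    next
      case False
      then show ?thesis
        using that(1,2) by (metis in_keys_iff subsetD)
    qed
  qed
  obtain \<alpha> where \<alpha>: "keys \<alpha> \<subseteq> {1..N}" "lookup (\<eta>\<^sub>1 ?r) \<alpha> \<noteq> 0"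
    and eq\<alpha>: "\<And>x. x \<in> ?D \<Longrightarrow> int n * int (lookup \<alpha> (reading ?D x)) = int m * (int (position ?D x) - content x)"
    by (rule s1.row_vector_coefficient) (rule that; blast)
  \<comment> \<open>Chosen so that the coefficient of the row vector's image at \<alpha>
    cancels.\<close>
  define c where "c = lookup (\<eta>\<^sub>2 ?r) \<alpha> / lookup (\<eta>\<^sub>1 ?r) \<alpha>"
  define \<eta> where "\<eta> f = \<eta>\<^sub>2 f + scale (- c) (\<eta>\<^sub>1 f)" for f
  have "\<eta> f = 0" if "f \<in> ?S" for f
  proof (rule ccontr)
    assume "\<eta> f \<noteq> 0"
    have keys: "keys (\<eta> g) \<subseteq> keys (\<eta>\<^sub>2 g) \<union> keys (\<eta>\<^sub>1 g)" for g
      unfolding \<eta>_def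
      using Poly_Mapping.keys_add [of "\<eta>\<^sub>2 g" "scale (- c) (\<eta>\<^sub>1 g)"] keys_scale [of "- c" "\<eta>\<^sub>1 g"] by blast
    interpret s: singular_map N m n \<tau> \<eta> \<kappa>
    proof
      show "\<eta> (g + h) = \<eta> g + \<eta> h" if "g \<in> ?S" "h \<in> ?S" for g h
        using that by (simp add: \<eta>_def s1.add s2.add mpoly.scale_right_distrib)
      show "\<eta> (scale a g) = scale a (\<eta> g)" if "g \<in> ?S" for a g
        using that by (simp add: \<eta>_def s1.scale s2.scale mpoly.scale_right_diff_distrib mult.commute)
      show "\<eta> (act w g) = act w (\<eta> g)" if "w permutes {1..N}" "g \<in> ?S" for w g
        using that by (simp add: \<eta>_def s1.act s2.act act_diff act_scale)
      show "dunkl N \<kappa> i (\<eta> g) = 0" if "i \<in> {1..N}" "g \<in> ?S" for i g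
        unfolding \<eta>_def dunkl_linear using that by (simp add: s1.dunkl s2.dunkl)
      show "\<eta> g \<in> polys N" if "g \<in> ?S" for g
        using keys [of g] s1.polys [OF that] s2.polys [OF that] unfolding polys_def by blast
      obtain B C where "\<forall>f \<in> ?S. \<forall>\<alpha> \<in> keys (\<eta>\<^sub>1 f). sum_squares N \<alpha> \<le> B"
        "\<forall>f \<in> ?S. \<forall>\<alpha> \<in> keys (\<eta>\<^sub>2 f). sum_squares N \<alpha> \<le> C"
        using s1.bounded s2.bounded by blast
      then show "\<exists>B. \<forall>f \<in> ?S. \<forall>\<alpha> \<in> keys (\<eta> f). sum_squares N \<alpha> \<le> B"
        using keys by (intro exI [of _ "max B C"]) (fastforce simp: le_max_iff_disj)
      show "\<exists>f \<in> ?S. \<eta> f \<noteq> 0"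
        using \<open>f \<in> ?S\<close> \<open>\<eta> f \<noteq> 0\<close> by blast
    qed (use s1.part s1.m s1.n s1.\<kappa> s1.irreducible in auto)
    obtain \<beta> where \<beta>: "keys \<beta> \<subseteq> {1..N}" "lookup (\<eta> ?r) \<beta> \<noteq> 0"
      and eq\<beta>: "\<And>x. x \<in> ?D \<Longrightarrow> int n * int (lookup \<beta> (reading ?D x)) = int m * (int (position ?D x) - content x)"
      by (rule s.row_vector_coefficient) (rule that; blast)
    have "\<beta> = \<alpha>"
      by (rule unique [OF \<beta>(1) \<alpha>(1) eq\<beta> eq\<alpha>])
    moreover have "lookup (\<eta> ?r) \<alpha> = 0"
      using \<alpha>(2) by (simp add: \<eta>_def c_def lookup_minus)
    ultimately show False
      using \<beta>(2) by simp
  qed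
  then show ?thesis
    by (intro that [of c]) (simp add: \<eta>_def)
qed

theorem corollary2:
  fixes N m n :: nat and \<tau> :: "nat list" and \<kappa>\<^sub>0 :: rat
  assumes "m > 0" and "n > 0" and "\<kappa>\<^sub>0 = - (of_nat m / of_nat n)"
    and "is_partition \<tau> N"
  shows "\<exists>\<^sub>\<le>\<^sub>1 M. irreducible_submodule N M \<and> (\<exists>d. M \<subseteq> homogeneous N d) \<and>
           (\<forall>p \<in> M - {0}. singular N \<kappa>\<^sub>0 p) \<and> has_isotype N \<tau> M"
proof (rule Uniq_I)
  fix M M'
  assume M: "irreducible_submodule N M \<and> (\<exists>d. M \<subseteq> homogeneous N d) \<and>
      (\<forall>p \<in> M - {0}. singular N \<kappa>\<^sub>0 p) \<and> has_isotype N \<tau> M"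
    and M': "irreducible_submodule N M' \<and> (\<exists>d. M' \<subseteq> homogeneous N d) \<and>
      (\<forall>p \<in> M' - {0}. singular N \<kappa>\<^sub>0 p) \<and> has_isotype N \<tau> M'"
  let ?S = "specht_module N \<tau>"
  obtain d d' where hom: "M \<subseteq> homogeneous N d" "M' \<subseteq> homogeneous N d'"
    using M M' by blast
  obtain \<eta> where \<eta>: "singular_map N m n \<tau> \<eta> \<kappa>\<^sub>0" "\<eta> ` ?S = M"
    by (rule singular_map_of_submodule [OF assms(4,1-3) _ hom(1)]) (use M in auto)
  obtain \<eta>' where \<eta>': "singular_map N m n \<tau> \<eta>' \<kappa>\<^sub>0" "\<eta>' ` ?S = M'"
    by (rule singular_map_of_submodule [OF assms(4,1-3) _ hom(2)]) (use M' in auto)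
  obtain c where c: "\<And>f. f \<in> ?S \<Longrightarrow> \<eta>' f = scale c (\<eta> f)"
    using singular_map_unique [OF \<eta>(1) \<eta>'(1)] by blast
  have irr: "irreducible_submodule N M" "irreducible_submodule N M'"
    using M M' by simp_all
  have "scale c p \<in> M" if "p \<in> M" for p
    using irr(1) that by (simp add: irreducible_submodule_def sym_submodule_def mpoly.subspace_scale)
  then have "M' \<subseteq> M"
    using \<eta>(2) \<eta>'(2) c by auto
  \<comment> \<open>The possibility c = 0 falls under M' = {0}, which is excluded because
    irreducible modules are nonzero.\<close>
  then have "M' = {0} \<or> M' = M"
    using irr unfolding irreducible_submodule_def by blast
  then show "M = M'"
    using irr(2) by (auto simp: irreducible_submodule_def)
qed

end
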